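(* Let $\mathfrak g$ be an $8$-dimensional nilpotent Lie algebra. There is a weakly non-nilpotent complex structure on $\mathfrak g$ if and only if $\mathfrak g$ is isomorphic to one (and only one) of the following Lie algebras: $$ \begin{aligned} \mathfrak f_1&=(0,0,0,12,23,14-35,0,0),\\ \mathfrak f_2&=(0,0,12,13,23,14+25,0,0),\\ \mathfrak f_3&=(0,0,0,12,13,23,15+26,0),\\ \mathfrak f_4^{\gamma}&=(0,0,\gamma\cdot 12,13,14,23,26,16+24),\\ \mathfrak f_5^{\gamma}&=(0,0,0,13,23,34,\tfrac{\gamma}{2}\cdot 12+35,14+25),\\ \mathfrak f_6&=(0,0,12,13,23,14+25,16+35,26-34),\\ \mathfrak f_7&=(0,0,0,13,23,14+25,2\cdot 14+34,15+24+35),\\ \mathfrak f_8&=(0,0,12,13,23,14+25,2\cdot 14-26+34,15+16+24+35), \end{aligned} $$ where $\gamma\in\{0,1\}$.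
   Context: Lie algebras are real and finite-dimensional. The notation $\mathfrak g=(\sum_{i<j}c^1_{ij}\cdot ij,\ldots,\sum_{i<j}c^m_{ij}\cdot ij)$ means that $\mathfrak g$ is the $m$-dimensional Lie algebra whose dual $\mathfrak g^*$ has a basis $\{e^k\}_{k=1}^m$ with $de^k=\sum_{i<j}c^k_{ij}\,e^i\wedge e^j$, where $d$ is the Chevalley–Eilenberg differential $d\alpha(X,Y)=-\alpha([X,Y])$. For instance $(0,0,0,2\cdot 13)$ means $de^1=de^2=de^3=0$, $de^4=2\,e^1\wedge e^3$. A complex structure on a Lie algebra $\mathfrak g$ of even dimension is an endomorphism $J:\mathfrak g\to\mathfrak g$ with $J^2=-\mathrm{Id}$ and $[X,Y]+J[JX,Y]+J[X,JY]-[JX,JY]=0$ for all $X,Y\in\mathfrak g$. For nilpotent $\mathfrak g$, the ascending $J$-compatible series is $\mathfrak a_0(J)=\{0\}$, $\mathfrak a_k(J)=\{X\in\mathfrak g\mid [X,\mathfrak g]\subseteq\mathfrak a_{k-1}(J),\ [JX,\mathfrak g]\subseteq\mathfrak a_{k-1}(J)\}$ for $k\ge1$. $J$ is weakly non-nilpotent (WnN) if $\mathfrak a_1(J)\neq\{0\}$ and there is an integer $t>0$ with $\mathfrak a_t(J)=\mathfrak a_{t+l}(J)$ for every $l\ge1$ and $\mathfrak a_t(J)\neq\mathfrak g$. *)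

theory Defs
  imports "HOL-Analysis.Analysis"
begin

section \<open>Real Lie algebras and their complex structures\<close>

text \<open>A Lie algebra is given by its bracket on the underlying real vector space, which is
  the whole type. Finite-dimensionality is expressed where needed by a positive value of
  \<^term>\<open>dim UNIV\<close>: this function takes the value \<open>0\<close> on infinite-dimensional spaces.\<close>

locale lie_algebra =
  fixes br :: "'a::real_vector \<Rightarrow> 'a \<Rightarrow> 'a"
  assumes bilinear_br: "bilinear br"
    and alternating: "br x x = 0"
    and jacobi: "br x (br y z) + br y (br z x) + br z (br x y) = 0"

primrec lower_central :: "('a::real_vector \<Rightarrow> 'a \<Rightarrow> 'a) \<Rightarrow> nat \<Rightarrow> 'a set" where
  "lower_central br 0 = UNIV"
| "lower_central br (Suc k) = span {br x y | x y. y \<in> lower_central br k}"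

definition nilpotent :: "('a::real_vector \<Rightarrow> 'a \<Rightarrow> 'a) \<Rightarrow> bool" where
  "nilpotent br \<longleftrightarrow> (\<exists>k. lower_central br k = {0})"

definition lie_isomorphic ::
  "('a::real_vector \<Rightarrow> 'a \<Rightarrow> 'a) \<Rightarrow> ('b::real_vector \<Rightarrow> 'b \<Rightarrow> 'b) \<Rightarrow> bool" where
  "lie_isomorphic br br' \<longleftrightarrow>
     (\<exists>\<phi>. linear \<phi> \<and> bij \<phi> \<and> (\<forall>x y. \<phi> (br x y) = br' (\<phi> x) (\<phi> y)))"

definition complex_structure ::
  "('a::real_vector \<Rightarrow> 'a \<Rightarrow> 'a) \<Rightarrow> ('a \<Rightarrow> 'a) \<Rightarrow> bool" where
  "complex_structure br J \<longleftrightarrow>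
     linear J \<and> (\<forall>x. J (J x) = - x) \<and>
     (\<forall>x y. br x y + J (br (J x) y) + J (br x (J y)) - br (J x) (J y) = 0)"

text \<open>The ascending \<open>J\<close>-compatible series.\<close>

primrec asc_series :: "('a::real_vector \<Rightarrow> 'a \<Rightarrow> 'a) \<Rightarrow> ('a \<Rightarrow> 'a) \<Rightarrow> nat \<Rightarrow> 'a set" where
  "asc_series br J 0 = {0}"
| "asc_series br J (Suc k) =
     {x. (\<forall>y. br x y \<in> asc_series br J k) \<and> (\<forall>y. br (J x) y \<in> asc_series br J k)}"

definition weakly_non_nilpotent ::
  "('a::real_vector \<Rightarrow> 'a \<Rightarrow> 'a) \<Rightarrow> ('a \<Rightarrow> 'a) \<Rightarrow> bool" where
  "weakly_non_nilpotent br J \<longleftrightarrow>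
     asc_series br J 1 \<noteq> {0} \<and>
     (\<exists>t>0. (\<forall>l\<ge>1. asc_series br J t = asc_series br J (t + l)) \<and> asc_series br J t \<noteq> UNIV)"

section \<open>Structure equations\<close>

definition ce_d ::
  "('a::real_vector \<Rightarrow> 'a \<Rightarrow> 'a) \<Rightarrow> ('a \<Rightarrow> real) \<Rightarrow> 'a \<Rightarrow> 'a \<Rightarrow> real" where
  "ce_d br \<alpha> x y = - \<alpha> (br x y)"

definition wedge :: "('a \<Rightarrow> real) \<Rightarrow> ('a \<Rightarrow> real) \<Rightarrow> 'a \<Rightarrow> 'a \<Rightarrow> real" where
  "wedge \<alpha> \<beta> x y = \<alpha> x * \<beta> y - \<alpha> y * \<beta> x"

text \<open>The basis of the dual of \<open>\<real>\<^sup>8\<close> formed by the coordinate functionals. As usual for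
  \<^const>\<open>vector\<close>, coordinates are numbered from \<open>1\<close>; in the index type the numeral \<open>8\<close>
  denotes the same element as \<open>0\<close>, so that \<open>1, \<dots>, 8\<close> are still eight different indices.\<close>

definition coframe :: "8 \<Rightarrow> real ^ 8 \<Rightarrow> real" where
  "coframe k x = x $ k"

text \<open>In \<open>structure_eqs (\<lambda>e. [\<omega>\<^sub>1, \<dots>, \<omega>\<^sub>8])\<close> the term \<open>e i j\<close> plays the role of the \<open>ij\<close> in the
  notation \<open>(\<omega>\<^sub>1, \<dots>, \<omega>\<^sub>8)\<close>, i.e. of \<open>e\<^sup>i \<and> e\<^sup>j\<close>; it is evaluated at the two arguments of the
  bracket. The minus sign is that of the Chevalley-Eilenberg differential, see
  \<open>ce_d_structure_eqs\<close> below.\<close>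

definition structure_eqs ::
  "((8 \<Rightarrow> 8 \<Rightarrow> real) \<Rightarrow> real list) \<Rightarrow> real ^ 8 \<Rightarrow> real ^ 8 \<Rightarrow> real ^ 8" where
  "structure_eqs F x y =
     vector (map uminus (F (\<lambda>i j. wedge (coframe i) (coframe j) x y)))"

definition f1 :: "real ^ 8 \<Rightarrow> real ^ 8 \<Rightarrow> real ^ 8" where
  "f1 = structure_eqs (\<lambda>e. [0, 0, 0, e 1 2, e 2 3, e 1 4 - e 3 5, 0, 0])"

definition f2 :: "real ^ 8 \<Rightarrow> real ^ 8 \<Rightarrow> real ^ 8" where
  "f2 = structure_eqs (\<lambda>e. [0, 0, e 1 2, e 1 3, e 2 3, e 1 4 + e 2 5, 0, 0])"

definition f3 :: "real ^ 8 \<Rightarrow> real ^ 8 \<Rightarrow> real ^ 8" where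
  "f3 = structure_eqs (\<lambda>e. [0, 0, 0, e 1 2, e 1 3, e 2 3, e 1 5 + e 2 6, 0])"

definition f4 :: "real \<Rightarrow> real ^ 8 \<Rightarrow> real ^ 8 \<Rightarrow> real ^ 8" where
  "f4 \<gamma> = structure_eqs (\<lambda>e. [0, 0, \<gamma> * e 1 2, e 1 3, e 1 4, e 2 3, e 2 6, e 1 6 + e 2 4])"

definition f5 :: "real \<Rightarrow> real ^ 8 \<Rightarrow> real ^ 8 \<Rightarrow> real ^ 8" where
  "f5 \<gamma> = structure_eqs (\<lambda>e. [0, 0, 0, e 1 3, e 2 3, e 3 4, \<gamma> / 2 * e 1 2 + e 3 5, e 1 4 + e 2 5])"

definition f6 :: "real ^ 8 \<Rightarrow> real ^ 8 \<Rightarrow> real ^ 8" where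
  "f6 = structure_eqs (\<lambda>e. [0, 0, e 1 2, e 1 3, e 2 3, e 1 4 + e 2 5, e 1 6 + e 3 5, e 2 6 - e 3 4])"

definition f7 :: "real ^ 8 \<Rightarrow> real ^ 8 \<Rightarrow> real ^ 8" where
  "f7 = structure_eqs (\<lambda>e. [0, 0, 0, e 1 3, e 2 3, e 1 4 + e 2 5, 2 * e 1 4 + e 3 4,
     e 1 5 + e 2 4 + e 3 5])"

definition f8 :: "real ^ 8 \<Rightarrow> real ^ 8 \<Rightarrow> real ^ 8" where
  "f8 = structure_eqs (\<lambda>e. [0, 0, e 1 2, e 1 3, e 2 3, e 1 4 + e 2 5, 2 * e 1 4 - e 2 6 + e 3 4,
     e 1 5 + e 1 6 + e 2 4 + e 3 5])"

definition wnn_algebras :: "(real ^ 8 \<Rightarrow> real ^ 8 \<Rightarrow> real ^ 8) set" where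
  "wnn_algebras = {f1, f2, f3, f4 0, f4 1, f5 0, f5 1, f6, f7, f8}"

subsection \<open>Consistency of the definitions\<close>

lemma exhaust_8: "k = 1 \<or> k = 2 \<or> k = 3 \<or> k = 4 \<or> k = 5 \<or> k = 6 \<or> k = 7 \<or> k = 8" for k :: 8
proof (induct k)
  case (of_int z)
  then have "z = 0 \<or> z = 1 \<or> z = 2 \<or> z = 3 \<or> z = 4 \<or> z = 5 \<or> z = 6 \<or> z = 7" by fastforce
  then show ?case by auto
qed

lemma forall_8: "(\<forall>k::8. P k) \<longleftrightarrow> P 1 \<and> P 2 \<and> P 3 \<and> P 4 \<and> P 5 \<and> P 6 \<and> P 7 \<and> P 8"
  by (metis exhaust_8)

lemma vector_8:
  fixes a1 a2 a3 a4 a5 a6 a7 a8 :: "'a::zero"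
  defines "v \<equiv> vector [a1, a2, a3, a4, a5, a6, a7, a8] :: 'a ^ 8"
  shows "v $ 1 = a1" "v $ 2 = a2" "v $ 3 = a3" "v $ 4 = a4"
    "v $ 5 = a5" "v $ 6 = a6" "v $ 7 = a7" "v $ 8 = a8"
  unfolding v_def vector_def by simp_all

lemma ce_d_structure_eqs:
  assumes "\<And>e. length (F e) = 8" and "1 \<le> k" and "k \<le> 8"
  shows "ce_d (structure_eqs F) (coframe (of_nat k)) x y =
           F (\<lambda>i j. wedge (coframe i) (coframe j) x y) ! (k - 1)"
proof -
  let ?e = "\<lambda>i j. wedge (coframe i) (coframe j) x y"
  obtain a1 a2 a3 a4 a5 a6 a7 a8 where F: "F ?e = [a1, a2, a3, a4, a5, a6, a7, a8]"
    using assms(1)[of ?e] by (auto simp: length_Suc_conv eval_nat_numeral)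
  have "k \<in> {1, 2, 3, 4, 5, 6, 7, 8}"
    using assms(2,3) by auto
  then show ?thesis
    by (auto simp: ce_d_def structure_eqs_def coframe_def F vector_8)
qed

lemma lie_algebra_wnn_algebras: "f \<in> wnn_algebras \<Longrightarrow> lie_algebra f"
  unfolding lie_algebra_def bilinear_def wnn_algebras_def f1_def f2_def f3_def f4_def f5_def
    f6_def f7_def f8_def
  by (elim insertE emptyE; simp add: linear_iff structure_eqs_def vec_eq_iff forall_8 vector_8
      wedge_def coframe_def; simp add: field_simps)

lemma lower_central_subset:
  assumes "\<And>x y. y \<in> S \<Longrightarrow> br x y \<in> T" and "subspace T" and "lower_central br k \<subseteq> S"
  shows "lower_central br (Suc k) \<subseteq> T"
proof -
  have "{br x y | x y. y \<in> lower_central br k} \<subseteq> T"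
    using assms(1,3) by blast
  then show ?thesis
    using assms(2) by (simp add: span_minimal)
qed

lemma triangular_wnn_algebras:
  assumes "f \<in> wnn_algebras"
  shows "f x y $ 1 = 0 \<and> f x y $ 2 = 0 \<and>
    (y$1 = 0 \<and> y$2 = 0 \<longrightarrow> f x y $ 3 = 0) \<and>
    (y$1 = 0 \<and> y$2 = 0 \<and> y$3 = 0 \<longrightarrow> f x y $ 4 = 0) \<and>
    (y$1 = 0 \<and> y$2 = 0 \<and> y$3 = 0 \<and> y$4 = 0 \<longrightarrow> f x y $ 5 = 0) \<and>
    (y$1 = 0 \<and> y$2 = 0 \<and> y$3 = 0 \<and> y$4 = 0 \<and> y$5 = 0 \<longrightarrow> f x y $ 6 = 0) \<and>
    (y$1 = 0 \<and> y$2 = 0 \<and> y$3 = 0 \<and> y$4 = 0 \<and> y$5 = 0 \<and> y$6 = 0 \<longrightarrow>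
       f x y $ 7 = 0 \<and> f x y $ 8 = 0)"
  using assms
  unfolding wnn_algebras_def f1_def f2_def f3_def f4_def f5_def f6_def f7_def f8_def
  by (elim insertE emptyE; simp add: structure_eqs_def vector_8 wedge_def coframe_def)

lemma nilpotent_wnn_algebras:
  assumes "f \<in> wnn_algebras"
  shows "nilpotent f"
proof -
  note tri = triangular_wnn_algebras[OF assms]
  have 1: "lower_central f 1 \<subseteq> {y. y$1 = 0 \<and> y$2 = 0}"
    unfolding One_nat_def
    by (rule lower_central_subset[of UNIV]) (use tri in \<open>auto simp: subspace_def\<close>)
  have 2: "lower_central f (Suc 1) \<subseteq> {y. y$1 = 0 \<and> y$2 = 0 \<and> y$3 = 0}"
    by (rule lower_central_subset[OF _ _ 1]) (use tri in \<open>auto simp: subspace_def\<close>)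
  have 3: "lower_central f (Suc (Suc 1)) \<subseteq> {y. y$1 = 0 \<and> y$2 = 0 \<and> y$3 = 0 \<and> y$4 = 0}"
    by (rule lower_central_subset[OF _ _ 2]) (use tri in \<open>auto simp: subspace_def\<close>)
  have 4: "lower_central f (Suc (Suc (Suc 1))) \<subseteq>
      {y. y$1 = 0 \<and> y$2 = 0 \<and> y$3 = 0 \<and> y$4 = 0 \<and> y$5 = 0}"
    by (rule lower_central_subset[OF _ _ 3]) (use tri in \<open>auto simp: subspace_def\<close>)
  have 5: "lower_central f (Suc (Suc (Suc (Suc 1)))) \<subseteq>
      {y. y$1 = 0 \<and> y$2 = 0 \<and> y$3 = 0 \<and> y$4 = 0 \<and> y$5 = 0 \<and> y$6 = 0}"
    by (rule lower_central_subset[OF _ _ 4]) (use tri in \<open>auto simp: subspace_def\<close>)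
  have "lower_central f (Suc (Suc (Suc (Suc (Suc 1))))) \<subseteq> {0}"
    by (rule lower_central_subset[OF _ _ 5])
      (use tri in \<open>auto simp: subspace_def vec_eq_iff forall_8\<close>)
  moreover have "0 \<in> lower_central f (Suc (Suc (Suc (Suc (Suc 1)))))"
    by (simp add: span_zero)
  ultimately show ?thesis
    unfolding nilpotent_def by blast
qed

end

theory Submission
  imports Defs
begin

text \<open>Let \<open>J\<close> be weakly non-nilpotent on the nilpotent algebra \<open>\<gg>\<close> and let \<open>A\<close> be the stable term
  of its ascending series. Then \<open>A \<noteq> \<gg>\<close> is a \<open>J\<close>-invariant ideal containing a central
  \<open>J\<close>-invariant plane, and no \<open>J\<close>-invariant plane of \<open>\<gg> / A\<close> is central. Take \<open>z \<notin> A\<close> that is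
  central modulo \<open>A\<close>. Integrability says that \<open>ad (J z)\<close> commutes with \<open>J\<close> modulo \<open>A\<close>, so it is a
  complex linear nilpotent map of \<open>\<gg> / A\<close>; nilpotency of \<open>\<gg>\<close> forbids \<open>[J z, y] = J z\<close> modulo \<open>A\<close>. From
  this one gets \<open>Y\<close> and \<open>u = [J z, Y]\<close> such that \<open>Y, u, z\<close> are independent over the complex numbers
  modulo \<open>A\<close> (\<open>adapted_independent\<close>). Counting dimensions, \<open>A\<close> is a single complex line, it is
  central, and \<open>Y, u, z\<close> together with a generator \<open>w\<close> of \<open>A\<close> are a complex basis of \<open>\<gg>\<close>.

  Nilpotency then determines the six-dimensional quotient (\<open>reduced_frame_exists\<close>): modulo \<open>A\<close> the
  only brackets are \<open>[J z, Y] = u\<close> and \<open>[Y, u] = [J Y, J u] = \<gamma> z\<close> with a real \<open>\<gamma> \<noteq> 0\<close>, the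
  \<open>J\<close>-image of the former, and, after a change of \<open>Y\<close>, the bracket \<open>[Y, J Y] = \<epsilon> J z\<close> with
  \<open>\<epsilon> \<in> {0, 1}\<close>. The Jacobi identity and
  integrability leave three free parameters in \<open>A\<close> for the extension (\<open>bracket_table\<close>):
  \<open>a = [Y, J u]\<close>, \<open>b = [Y, J Y] - \<epsilon> J z\<close> and \<open>e = [u, J z]\<close>. Choosing \<open>w\<close> as the first nonzero one
  among \<open>e, a, b\<close> puts \<open>\<gg>\<close> into a family of brackets on \<open>\<real>\<^sup>8\<close> with few real parameters
  (\<open>model\<close>). As a real algebra a member depends only on \<open>\<epsilon>\<close> and on which parameters vanish, and
  explicit linear maps identify the members with the ten algebras:
  \<^item> \<open>e = a = 0\<close>: \<open>f1\<close> or, if \<open>b \<noteq> 0\<close>, \<open>f3\<close> for \<open>\<epsilon> = 0\<close>, and \<open>f2\<close> for \<open>\<epsilon> = 1\<close>;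
  \<^item> \<open>e = 0\<close>, \<open>a \<noteq> 0\<close>: \<open>f4 \<epsilon>\<close>;
  \<^item> \<open>e \<noteq> 0\<close>, \<open>a = 0\<close>: \<open>f5 0\<close> or, if \<open>b \<noteq> 0\<close>, \<open>f5 1\<close> for \<open>\<epsilon> = 0\<close>, and \<open>f6\<close> for \<open>\<epsilon> = 1\<close>;
  \<^item> \<open>e \<noteq> 0\<close>, \<open>a \<noteq> 0\<close>: \<open>f7\<close> for \<open>\<epsilon> = 0\<close>, and \<open>f8\<close> for \<open>\<epsilon> = 1\<close>.

  Conversely every member of the family carries a weakly non-nilpotent complex structure
  (\<open>model_wnn\<close>), which is transported along the same maps. Finally, six properties that are
  phrased in terms of the bracket only take different values on the ten algebras
  (\<open>wnn_algebras_distinguished\<close>), so no two of them are isomorphic.\<close>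

section \<open>Transport along isomorphisms\<close>

lemma lie_isomorphic_sym:
  assumes "lie_isomorphic br br'"
  shows "lie_isomorphic br' br"
proof -
  obtain \<phi> where \<phi>: "linear \<phi>" "bij \<phi>" "\<And>x y. \<phi> (br x y) = br' (\<phi> x) (\<phi> y)"
    using assms unfolding lie_isomorphic_def by blast
  have *: "\<phi> (inv \<phi> x) = x" "inv \<phi> (\<phi> y) = y" for x y
    using \<phi>(2) by (simp_all add: bij_is_surj surj_f_inv_f bij_is_inj)
  have "linear (inv \<phi>)"
    by (rule linearI; rule injD[OF bij_is_inj[OF \<phi>(2)]])
      (simp_all add: * linear_add[OF \<phi>(1)] linear_scale[OF \<phi>(1)])
  moreover have "bij (inv \<phi>)"
    using \<phi>(2) by (rule bij_imp_bij_inv)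
  moreover have "inv \<phi> (br' x y) = br (inv \<phi> x) (inv \<phi> y)" for x y
    by (rule injD[OF bij_is_inj[OF \<phi>(2)]]) (simp add: * \<phi>(3))
  ultimately show ?thesis
    unfolding lie_isomorphic_def by blast
qed

lemma lie_isomorphic_trans:
  assumes "lie_isomorphic br br'" "lie_isomorphic br' br''"
  shows "lie_isomorphic br br''"
proof -
  obtain \<phi> where \<phi>: "linear \<phi>" "bij \<phi>" "\<And>x y. \<phi> (br x y) = br' (\<phi> x) (\<phi> y)"
    using assms(1) unfolding lie_isomorphic_def by blast
  obtain \<psi> where \<psi>: "linear \<psi>" "bij \<psi>" "\<And>x y. \<psi> (br' x y) = br'' (\<psi> x) (\<psi> y)"
    using assms(2) unfolding lie_isomorphic_def by blast
  have "linear (\<psi> \<circ> \<phi>)" "bij (\<psi> \<circ> \<phi>)"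
    using \<phi> \<psi> by (auto intro: linear_compose bij_comp)
  then show ?thesis
    unfolding lie_isomorphic_def using \<phi>(3) \<psi>(3) by (intro exI[of _ "\<psi> \<circ> \<phi>"]) simp
qed

text \<open>The structure is pulled back; the ascending series of the pullback is the preimage of the
  ascending series, so the two series stabilise together.\<close>
lemma wnn_transfer:
  assumes "lie_isomorphic br br'" "complex_structure br' J" "weakly_non_nilpotent br' J"
  shows "\<exists>J. complex_structure br J \<and> weakly_non_nilpotent br J"
proof -
  obtain \<phi> where \<phi>: "linear \<phi>" "bij \<phi>" "\<And>x y. \<phi> (br x y) = br' (\<phi> x) (\<phi> y)"
    using assms(1) unfolding lie_isomorphic_def by blast
  have *: "\<phi> (inv \<phi> x) = x" "inv \<phi> (\<phi> y) = y" for x y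
    using \<phi>(2) by (simp_all add: bij_is_surj surj_f_inv_f bij_is_inj)
  note inj = injD[OF bij_is_inj[OF \<phi>(2)]]
  note [simp] = linear_add[OF \<phi>(1)] linear_scale[OF \<phi>(1)] linear_diff[OF \<phi>(1)]
    linear_neg[OF \<phi>(1)] linear_0[OF \<phi>(1)]
  define K where "K x = inv \<phi> (J (\<phi> x))" for x
  have \<phi>K: "\<phi> (K x) = J (\<phi> x)" for x
    by (simp add: K_def *)
  have J: "linear J" "\<And>x. J (J x) = - x"
    "\<And>x y. br' x y + J (br' (J x) y) + J (br' x (J y)) - br' (J x) (J y) = 0"
    using assms(2) by (auto simp: complex_structure_def)
  have "complex_structure br K"
    unfolding complex_structure_def
  proof (intro conjI allI)
    show "linear K"
      by (rule linearI; rule inj) (simp_all add: \<phi>K linear_add[OF J(1)] linear_scale[OF J(1)])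
    show "K (K x) = - x" for x
      by (rule inj) (simp add: \<phi>K J(2))
    show "br x y + K (br (K x) y) + K (br x (K y)) - br (K x) (K y) = 0" for x y
      by (rule inj) (simp add: \<phi>K \<phi>(3) J(3))
  qed
  have asc: "asc_series br K k = \<phi> -` asc_series br' J k" for k
  proof (induction k)
    case 0
    then show ?case using inj[of _ 0] by auto
  next
    case (Suc k)
    have "(\<forall>y. br' v (\<phi> y) \<in> S) \<longleftrightarrow> (\<forall>y. br' v y \<in> S)" for v S
      by (metis *(1))
    then show ?case
      by (auto simp: Suc \<phi>(3) \<phi>K)
  qed
  have vim: "\<phi> -` S = \<phi> -` T \<longleftrightarrow> S = T" for S T
    using bij_is_surj[OF \<phi>(2)] by (metis surj_image_vimage_eq)
  have "\<phi> -` {0} = {0}" "\<phi> -` UNIV = UNIV"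
    using inj[of _ 0] by auto
  then have "weakly_non_nilpotent br K"
    using assms(3) unfolding weakly_non_nilpotent_def asc by (metis vim)
  with \<open>complex_structure br K\<close> show ?thesis by blast
qed

section \<open>Isomorphism invariants that separate the ten algebras\<close>

definition three_step :: "('a::real_vector \<Rightarrow> 'a \<Rightarrow> 'a) \<Rightarrow> bool" where
  "three_step br \<longleftrightarrow> (\<forall>a b c d. br a (br b (br c d)) = 0)"

definition four_step :: "('a::real_vector \<Rightarrow> 'a \<Rightarrow> 'a) \<Rightarrow> bool" where
  "four_step br \<longleftrightarrow> (\<forall>a b c d e. br a (br b (br c (br d e))) = 0)"

text \<open>For \<open>x = e\<^sub>1\<close> and \<open>y = e\<^sub>2\<close> in \<open>f2\<close> and \<open>f6\<close>, the brackets \<open>[v, [v', [x, y]]]\<close> with \<open>v\<close> and \<open>v'\<close>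
  among \<open>x\<close> and \<open>y\<close> are the values of the Euclidean inner product, times a fixed vector. In \<open>f4 1\<close>
  and \<open>f8\<close> they involve the symmetric product of \<open>v\<close> and \<open>v'\<close>, and that never vanishes on a
  pair of generators.\<close>
definition has_conformal_generators :: "('a::real_vector \<Rightarrow> 'a \<Rightarrow> 'a) \<Rightarrow> bool" where
  "has_conformal_generators br \<longleftrightarrow> (\<exists>x y. br x (br y (br x y)) = 0 \<and>
     br x (br x (br x y)) = br y (br y (br x y)) \<and> br x (br x (br x y)) \<noteq> 0)"

definition has_active_centraliser :: "('a::real_vector \<Rightarrow> 'a \<Rightarrow> 'a) \<Rightarrow> bool" where
  "has_active_centraliser br \<longleftrightarrow> (\<exists>x a. (\<forall>b c. br x (br b c) = 0) \<and> br a (br a x) \<noteq> 0)"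

text \<open>The same pattern for algebras of step three, where it can be tested on all of the algebra.\<close>
definition conformal_pair :: "('a::real_vector \<Rightarrow> 'a \<Rightarrow> 'a) \<Rightarrow> 'a \<Rightarrow> 'a \<Rightarrow> bool" where
  "conformal_pair br x y \<longleftrightarrow> (\<forall>b. br x (br y b) = 0 \<and> br y (br x b) = 0) \<and>
     (\<exists>a. br x (br x a) = br y (br y a) \<and> br x (br x a) \<noteq> 0)"

definition has_conformal_pair :: "('a::real_vector \<Rightarrow> 'a \<Rightarrow> 'a) \<Rightarrow> bool" where
  "has_conformal_pair br \<longleftrightarrow> (\<exists>x y. conformal_pair br x y)"

definition has_commuting_conformal_pair :: "('a::real_vector \<Rightarrow> 'a \<Rightarrow> 'a) \<Rightarrow> bool" where
  "has_commuting_conformal_pair br \<longleftrightarrow> (\<exists>x y. conformal_pair br x y \<and> br x y = 0)"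

definition bracket_invariants where
  "bracket_invariants br = (three_step br, four_step br, has_conformal_generators br,
      has_active_centraliser br, has_conformal_pair br, has_commuting_conformal_pair br)"

lemma bracket_invariants_cong:
  fixes br :: "'a::real_vector \<Rightarrow> 'a \<Rightarrow> 'a" and br' :: "'b::real_vector \<Rightarrow> 'b \<Rightarrow> 'b"
  assumes "lie_isomorphic br br'"
  shows "bracket_invariants br = bracket_invariants br'"
proof -
  obtain \<phi> where \<phi>: "linear \<phi>" "bij \<phi>" "\<And>x y. \<phi> (br x y) = br' (\<phi> x) (\<phi> y)"
    using assms unfolding lie_isomorphic_def by blast
  have eq: "\<phi> x = \<phi> y \<longleftrightarrow> x = y" and z: "\<phi> x = 0 \<longleftrightarrow> x = 0" for x y
    using linear_0[OF \<phi>(1)] bij_is_inj[OF \<phi>(2)] by (metis injD)+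
  have al: "(\<forall>x. P x) \<longleftrightarrow> (\<forall>x. P (\<phi> x))" and ex: "(\<exists>x. P x) \<longleftrightarrow> (\<exists>x. P (\<phi> x))" for P :: "'b \<Rightarrow> bool"
    using bij_is_surj[OF \<phi>(2)] by (metis surj_def)+
  show ?thesis
    unfolding bracket_invariants_def three_step_def four_step_def has_conformal_generators_def
        has_active_centraliser_def has_conformal_pair_def has_commuting_conformal_pair_def
        conformal_pair_def
    by (simp only: al ex \<phi>(3)[symmetric] z eq)
qed

lemmas coord_simps = structure_eqs_def vector_8 wedge_def coframe_def vec_eq_iff forall_8

definition unit8 :: "8 \<Rightarrow> real ^ 8" where "unit8 k = axis k 1"

lemma unit8_nth [simp]: "unit8 k $ i = (if i = k then 1 else 0)"
  by (simp add: unit8_def axis_def)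

lemma has_commuting_conformal_pair_imp_has_conformal_pair:
  "has_commuting_conformal_pair br \<Longrightarrow> has_conformal_pair br"
  by (auto simp: has_commuting_conformal_pair_def has_conformal_pair_def)

lemma has_conformal_generatorsI:
  "br x (br y (br x y)) = 0 \<Longrightarrow> br x (br x (br x y)) = br y (br y (br x y)) \<Longrightarrow>
   br x (br x (br x y)) \<noteq> 0 \<Longrightarrow> has_conformal_generators br"
  unfolding has_conformal_generators_def by blast

lemma has_commuting_conformal_pairI: "(\<And>b. br x (br y b) = 0) \<Longrightarrow> (\<And>b. br y (br x b) = 0) \<Longrightarrow> br x y = 0 \<Longrightarrow>
   br x (br x a) = br y (br y a) \<Longrightarrow> br x (br x a) \<noteq> 0 \<Longrightarrow> has_commuting_conformal_pair br"
  unfolding has_commuting_conformal_pair_def conformal_pair_def by blast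

lemma has_conformal_pairI: "(\<And>b. br x (br y b) = 0) \<Longrightarrow> (\<And>b. br y (br x b) = 0) \<Longrightarrow>
   br x (br x a) = br y (br y a) \<Longrightarrow> br x (br x a) \<noteq> 0 \<Longrightarrow> has_conformal_pair br"
  unfolding has_conformal_pair_def conformal_pair_def by blast

lemma has_active_centraliserI:
  "(\<And>b c. br x (br b c) = 0) \<Longrightarrow> br a (br a x) \<noteq> 0 \<Longrightarrow> has_active_centraliser br"
  by (auto simp: has_active_centraliser_def)

lemma not_four_step_imp_not_three_step: "\<not> four_step br \<Longrightarrow> \<not> three_step br"
  unfolding three_step_def four_step_def by blast

lemma not_three_stepI: "br a (br b (br c d)) \<noteq> 0 \<Longrightarrow> \<not> three_step br"
  by (auto simp: three_step_def)

lemma not_four_stepI: "br a (br b (br c (br d e))) \<noteq> 0 \<Longrightarrow> \<not> four_step br"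
  unfolding four_step_def by blast

lemma three_step_f1: "three_step f1"
  by (simp add: three_step_def f1_def coord_simps)

lemma three_step_f3: "three_step f3"
  by (simp add: three_step_def f3_def coord_simps)

lemma three_step_f4_0: "three_step (f4 0)"
  by (simp add: three_step_def f4_def coord_simps)

lemma three_step_f5: "three_step (f5 r)"
  by (simp add: three_step_def f5_def coord_simps)

lemma three_step_f7: "three_step f7"
  by (simp add: three_step_def f7_def coord_simps)

lemma four_step_f2: "four_step f2"
  by (simp add: four_step_def f2_def coord_simps)

lemma four_step_f4_1: "four_step (f4 1)"
  by (simp add: four_step_def f4_def coord_simps)

lemma not_three_step_f2: "\<not> three_step f2"
  by (rule not_three_stepI[of _ "unit8 1" "unit8 1" "unit8 1" "unit8 2"]) (simp add: f2_def coord_simps)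

lemma not_three_step_f4_1: "\<not> three_step (f4 1)"
  by (rule not_three_stepI[of _ "unit8 1" "unit8 1" "unit8 1" "unit8 2"]) (simp add: f4_def coord_simps)

lemma not_four_step_f6: "\<not> four_step f6"
  by (rule not_four_stepI[of _ "unit8 1" "unit8 1" "unit8 1" "unit8 1" "unit8 2"]) (simp add: f6_def
      coord_simps)

lemma not_four_step_f8: "\<not> four_step f8"
  by (rule not_four_stepI[of _ "unit8 1" "unit8 1" "unit8 1" "unit8 1" "unit8 2"]) (simp add: f8_def
      coord_simps)

lemma has_conformal_generators_f2: "has_conformal_generators f2"
  by (rule has_conformal_generatorsI[of _ "unit8 1" "unit8 2"]) (simp_all add: f2_def coord_simps)

lemma has_conformal_generators_f6: "has_conformal_generators f6"
  by (rule has_conformal_generatorsI[of _ "unit8 1" "unit8 2"]) (simp_all add: f6_def coord_simps)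

lemma has_commuting_conformal_pair_f1: "has_commuting_conformal_pair f1"
  by (rule has_commuting_conformal_pairI[of _ "unit8 1" "unit8 3" "unit8 2"]) (simp_all add: f1_def
      coord_simps)

lemma has_commuting_conformal_pair_f5_0: "has_commuting_conformal_pair (f5 0)"
  by (rule has_commuting_conformal_pairI[of _ "unit8 1" "unit8 2" "unit8 3"]) (simp_all add: f5_def
      coord_simps)

lemma has_conformal_pair_f3: "has_conformal_pair f3"
  by (rule has_conformal_pairI[of _ "unit8 1" "unit8 2" "unit8 3"]) (simp_all add: f3_def coord_simps)

lemma has_conformal_pair_f5_1: "has_conformal_pair (f5 1)"
  by (rule has_conformal_pairI[of _ "unit8 1" "unit8 2" "unit8 3"]) (simp_all add: f5_def coord_simps)

lemma has_active_centraliser_f1: "has_active_centraliser f1"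
  by (rule has_active_centraliserI[of _ "unit8 2" "unit8 1"]) (simp_all add: f1_def coord_simps)

lemma has_active_centraliser_f3: "has_active_centraliser f3"
  by (rule has_active_centraliserI[of _ "unit8 3" "unit8 1"]) (simp_all add: f3_def coord_simps)

lemma has_active_centraliser_f4_0: "has_active_centraliser (f4 0)"
  by (rule has_active_centraliserI[of _ "unit8 3" "unit8 1"]) (simp_all add: f4_def coord_simps)

lemma not_has_active_centraliser_f5: "\<not> has_active_centraliser (f5 r)"
proof
  assume "has_active_centraliser (f5 r)"
  then obtain x a where x: "\<And>b c. f5 r x (f5 r b c) = 0" and a: "f5 r a (f5 r a x) \<noteq> 0"
    by (auto simp: has_active_centraliser_def)
  have "x $ 1 = 0 \<and> x $ 2 = 0 \<and> x $ 3 = 0"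
    using x[of "unit8 1" "unit8 3"] x[of "unit8 2" "unit8 3"] by (simp add: f5_def coord_simps)
  then have "f5 r a (f5 r a x) = 0"
    by (simp add: f5_def coord_simps)
  with a show False by contradiction
qed

lemma not_has_active_centraliser_f7: "\<not> has_active_centraliser f7"
proof
  assume "has_active_centraliser f7"
  then obtain x a where x: "\<And>b c. f7 x (f7 b c) = 0" and a: "f7 a (f7 a x) \<noteq> 0"
    by (auto simp: has_active_centraliser_def)
  have "x $ 1 = 0 \<and> x $ 2 = 0 \<and> x $ 3 = 0"
    using x[of "unit8 1" "unit8 3"] x[of "unit8 2" "unit8 3"] by (simp add: f7_def coord_simps)
  then have "f7 a (f7 a x) = 0"
    by (simp add: f7_def coord_simps)
  with a show False by contradiction
qed

text \<open>The symmetric product of two vectors of the plane vanishes only if one of them does. In the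
  algebras \<open>f4\<close>, \<open>f7\<close> and \<open>f8\<close> a vanishing mixed bracket leads to the vanishing of such a product.\<close>
lemma symmetric_product_eq_0:
  fixes a b c d :: real
  assumes "a * c = 0" "b * d = 0" "a * d + b * c = 0"
  shows "a = 0 \<and> b = 0 \<or> c = 0 \<and> d = 0"
  using assms by auto

text \<open>In \<open>f3\<close> and \<open>f5 1\<close> the members of a conformal pair are orthogonal in their first two
  coordinates, whereas commuting makes these coordinates parallel.\<close>
lemma dot_cross_eq_0:
  fixes a b c d :: real
  assumes "a * c + b * d = 0" "a * d - b * c = 0"
  shows "a = 0 \<and> b = 0 \<or> c = 0 \<and> d = 0"
proof -
  have "(a\<^sup>2 + b\<^sup>2) * (c\<^sup>2 + d\<^sup>2) = (a * c + b * d)\<^sup>2 + (a * d - b * c)\<^sup>2"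
    by algebra
  then show ?thesis
    using assms by (auto simp: sum_power2_eq_zero_iff)
qed

text \<open>The coordinates of the brackets. Rewriting with them keeps iterated brackets small, whereas
  unfolding the structure equations would copy whole vectors.\<close>
lemma f3_nth:
  "f3 x v $ 1 = 0"
  "f3 x v $ 2 = 0"
  "f3 x v $ 3 = 0"
  "f3 x v $ 4 = (x $ 2 * v $ 1 - x $ 1 * v $ 2)"
  "f3 x v $ 5 = (x $ 3 * v $ 1 - x $ 1 * v $ 3)"
  "f3 x v $ 6 = (x $ 3 * v $ 2 - x $ 2 * v $ 3)"
  "f3 x v $ 7 = (x $ 5 * v $ 1 - x $ 1 * v $ 5) + (x $ 6 * v $ 2 - x $ 2 * v $ 6)"
  "f3 x v $ 8 = 0"
  by (simp_all add: f3_def coord_simps algebra_simps add_divide_distrib diff_divide_distrib)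

lemma f4_nth:
  "f4 \<gamma> x v $ 1 = 0"
  "f4 \<gamma> x v $ 2 = 0"
  "f4 \<gamma> x v $ 3 = \<gamma> * (x $ 2 * v $ 1 - x $ 1 * v $ 2)"
  "f4 \<gamma> x v $ 4 = (x $ 3 * v $ 1 - x $ 1 * v $ 3)"
  "f4 \<gamma> x v $ 5 = (x $ 4 * v $ 1 - x $ 1 * v $ 4)"
  "f4 \<gamma> x v $ 6 = (x $ 3 * v $ 2 - x $ 2 * v $ 3)"
  "f4 \<gamma> x v $ 7 = (x $ 6 * v $ 2 - x $ 2 * v $ 6)"
  "f4 \<gamma> x v $ 8 = (x $ 6 * v $ 1 - x $ 1 * v $ 6) + (x $ 4 * v $ 2 - x $ 2 * v $ 4)"
  by (simp_all add: f4_def coord_simps algebra_simps add_divide_distrib diff_divide_distrib)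

lemma f5_nth:
  "f5 \<gamma> x v $ 1 = 0"
  "f5 \<gamma> x v $ 2 = 0"
  "f5 \<gamma> x v $ 3 = 0"
  "f5 \<gamma> x v $ 4 = (x $ 3 * v $ 1 - x $ 1 * v $ 3)"
  "f5 \<gamma> x v $ 5 = (x $ 3 * v $ 2 - x $ 2 * v $ 3)"
  "f5 \<gamma> x v $ 6 = (x $ 4 * v $ 3 - x $ 3 * v $ 4)"
  "f5 \<gamma> x v $ 7 = \<gamma> / 2 * (x $ 2 * v $ 1 - x $ 1 * v $ 2) + (x $ 5 * v $ 3 - x $ 3 * v $ 5)"
  "f5 \<gamma> x v $ 8 = (x $ 4 * v $ 1 - x $ 1 * v $ 4) + (x $ 5 * v $ 2 - x $ 2 * v $ 5)"
  by (simp_all add: f5_def coord_simps algebra_simps add_divide_distrib diff_divide_distrib)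

lemma f7_nth:
  "f7 x v $ 1 = 0"
  "f7 x v $ 2 = 0"
  "f7 x v $ 3 = 0"
  "f7 x v $ 4 = (x $ 3 * v $ 1 - x $ 1 * v $ 3)"
  "f7 x v $ 5 = (x $ 3 * v $ 2 - x $ 2 * v $ 3)"
  "f7 x v $ 6 = (x $ 4 * v $ 1 - x $ 1 * v $ 4) + (x $ 5 * v $ 2 - x $ 2 * v $ 5)"
  "f7 x v $ 7 = 2 * (x $ 4 * v $ 1 - x $ 1 * v $ 4) + (x $ 4 * v $ 3 - x $ 3 * v $ 4)"
  "f7 x v $ 8 = (x $ 5 * v $ 1 - x $ 1 * v $ 5) + (x $ 4 * v $ 2 - x $ 2 * v $ 4)
      + (x $ 5 * v $ 3 - x $ 3 * v $ 5)"
  by (simp_all add: f7_def coord_simps algebra_simps add_divide_distrib diff_divide_distrib)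

lemma f8_nth:
  "f8 x v $ 1 = 0"
  "f8 x v $ 2 = 0"
  "f8 x v $ 3 = (x $ 2 * v $ 1 - x $ 1 * v $ 2)"
  "f8 x v $ 4 = (x $ 3 * v $ 1 - x $ 1 * v $ 3)"
  "f8 x v $ 5 = (x $ 3 * v $ 2 - x $ 2 * v $ 3)"
  "f8 x v $ 6 = (x $ 4 * v $ 1 - x $ 1 * v $ 4) + (x $ 5 * v $ 2 - x $ 2 * v $ 5)"
  "f8 x v $ 7 = 2 * (x $ 4 * v $ 1 - x $ 1 * v $ 4) - (x $ 6 * v $ 2 - x $ 2 * v $ 6)
      + (x $ 4 * v $ 3 - x $ 3 * v $ 4)"
  "f8 x v $ 8 = (x $ 5 * v $ 1 - x $ 1 * v $ 5) + (x $ 6 * v $ 1 - x $ 1 * v $ 6)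
      + (x $ 4 * v $ 2 - x $ 2 * v $ 4) + (x $ 5 * v $ 3 - x $ 3 * v $ 5)"
  by (simp_all add: f8_def coord_simps algebra_simps add_divide_distrib diff_divide_distrib)

lemma not_has_conformal_pair_f4_0: "\<not> has_conformal_pair (f4 0)"
proof
  assume "has_conformal_pair (f4 0)"
  then obtain x y a where xy: "\<And>b. f4 0 x (f4 0 y b) = 0" "\<And>b. f4 0 y (f4 0 x b) = 0"
      and a: "f4 0 x (f4 0 x a) = f4 0 y (f4 0 y a)" "f4 0 x (f4 0 x a) \<noteq> 0"
    unfolding has_conformal_pair_def conformal_pair_def by blast
  have nz: "\<not> (x $ 1 = 0 \<and> x $ 2 = 0)" "\<not> (y $ 1 = 0 \<and> y $ 2 = 0)"
    using a by (auto simp: vec_eq_iff forall_8 f4_nth)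
  have "x $ 1 * y $ 1 = 0" "x $ 2 * y $ 2 = 0" "x $ 1 * y $ 2 + x $ 2 * y $ 1 = 0"
    using xy(1)[of "unit8 3"] by (simp_all add: vec_eq_iff forall_8 f4_nth)
  from symmetric_product_eq_0[OF this] nz show False by blast
qed

text \<open>If one member \<open>w\<close> of the pair had a component along \<open>e\<^sub>3\<close>, then the brackets with \<open>w\<close> would
  exhaust the derived algebra modulo the centre; the other member \<open>v\<close> would centralise the derived
  algebra, hence lie in it, and \<open>[v, [v, a]]\<close> would vanish. Without these components the mixed
  brackets are a symmetric product.\<close>
lemma not_has_conformal_pair_f7: "\<not> has_conformal_pair f7"
proof
  assume "has_conformal_pair f7"
  then obtain x y a where xy: "\<And>b. f7 x (f7 y b) = 0" "\<And>b. f7 y (f7 x b) = 0"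
      and a: "f7 x (f7 x a) = f7 y (f7 y a)" "f7 x (f7 x a) \<noteq> 0"
    unfolding has_conformal_pair_def conformal_pair_def by blast
  have nz: "\<not> (x $ 1 = 0 \<and> x $ 2 = 0 \<and> x $ 3 = 0)" "\<not> (y $ 1 = 0 \<and> y $ 2 = 0 \<and> y $ 3 = 0)"
    using a by (auto simp: vec_eq_iff forall_8 f7_nth)
  have third: "w $ 3 = 0" if "\<And>b. f7 v (f7 w b) = 0" "\<not> (v $ 1 = 0 \<and> v $ 2 = 0 \<and> v $ 3 = 0)" for v w
    using that(1)[of "unit8 1"] that(1)[of "unit8 2"] that(2)
    by (auto simp: vec_eq_iff forall_8 f7_nth)
  have 3: "x $ 3 = 0" "y $ 3 = 0"
    using third[OF xy(2)] third[OF xy(1)] nz by blast+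
  have "x $ 1 * y $ 1 = 0" "x $ 2 * y $ 2 = 0" "x $ 1 * y $ 2 + x $ 2 * y $ 1 = 0"
    using xy(1)[of "unit8 3"] 3 by (auto simp add: vec_eq_iff forall_8 f7_nth)
  from symmetric_product_eq_0[OF this] nz 3 show False by blast
qed

lemma not_has_commuting_conformal_pair_f3: "\<not> has_commuting_conformal_pair f3"
proof
  assume "has_commuting_conformal_pair f3"
  then obtain x y a where xy: "\<And>b. f3 x (f3 y b) = 0" "\<And>b. f3 y (f3 x b) = 0" "f3 x y = 0"
      and a: "f3 x (f3 x a) = f3 y (f3 y a)" "f3 x (f3 x a) \<noteq> 0"
    unfolding has_commuting_conformal_pair_def conformal_pair_def by blast
  have nz: "\<not> (x $ 1 = 0 \<and> x $ 2 = 0)" "\<not> (y $ 1 = 0 \<and> y $ 2 = 0)"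
    using a by (auto simp: vec_eq_iff forall_8 f3_nth)
  have "x $ 1 * y $ 1 + x $ 2 * y $ 2 = 0" "x $ 1 * y $ 2 - x $ 2 * y $ 1 = 0"
    using xy(1)[of "unit8 3"] xy(3) by (simp_all add: vec_eq_iff forall_8 f3_nth)
  from dot_cross_eq_0[OF this] nz show False by blast
qed

lemma not_has_commuting_conformal_pair_f5_1: "\<not> has_commuting_conformal_pair (f5 1)"
proof
  assume "has_commuting_conformal_pair (f5 1)"
  then obtain x y a where xy: "\<And>b. f5 1 x (f5 1 y b) = 0" "\<And>b. f5 1 y (f5 1 x b) = 0" "f5 1 x y = 0"
      and a: "f5 1 x (f5 1 x a) = f5 1 y (f5 1 y a)" "f5 1 x (f5 1 x a) \<noteq> 0"
    unfolding has_commuting_conformal_pair_def conformal_pair_def by blast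
  have nz: "\<not> (x $ 1 = 0 \<and> x $ 2 = 0 \<and> x $ 3 = 0)" "\<not> (y $ 1 = 0 \<and> y $ 2 = 0 \<and> y $ 3 = 0)"
    using a by (auto simp: vec_eq_iff forall_8 f5_nth)
  have third: "w $ 3 = 0" if "\<And>b. f5 1 v (f5 1 w b) = 0" "\<not> (v $ 1 = 0 \<and> v $ 2 = 0 \<and> v $ 3 = 0)" for v w
    using that(1)[of "unit8 1"] that(1)[of "unit8 2"] that(2)
    by (auto simp: vec_eq_iff forall_8 f5_nth)
  have 3: "x $ 3 = 0" "y $ 3 = 0"
    using third[OF xy(2)] third[OF xy(1)] nz by blast+
  have "x $ 1 * y $ 1 + x $ 2 * y $ 2 = 0" "x $ 1 * y $ 2 - x $ 2 * y $ 1 = 0"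
    using xy(1)[of "unit8 3"] xy(3) 3 by (simp_all add: vec_eq_iff forall_8 f5_nth)
  from dot_cross_eq_0[OF this] nz 3 show False by blast
qed

lemma not_has_conformal_generators_f4_1: "\<not> has_conformal_generators (f4 1)"
proof
  assume "has_conformal_generators (f4 1)"
  then obtain x y where 1: "f4 1 x (f4 1 y (f4 1 x y)) = 0" and 2: "f4 1 x (f4 1 x (f4 1 x y)) \<noteq> 0"
    unfolding has_conformal_generators_def by blast
  define D where "D = x $ 1 * y $ 2 - x $ 2 * y $ 1"
  have T: "f4 1 x y $ 3 = - D"
    by (simp add: f4_nth D_def)
  have "D \<noteq> 0"
    using 2 T by (auto simp: vec_eq_iff forall_8 f4_nth(1,2,4-)  f4_nth(3)[of 1 x "f4 1 x y"]
        f4_nth(3)[of 1 x "f4 1 x (f4 1 x y)"])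
  moreover have "D * (x $ 1 * y $ 1) = 0" "D * (x $ 2 * y $ 2) = 0"
      "D * (x $ 1 * y $ 2 + x $ 2 * y $ 1) = 0"
    using 1 unfolding vec_eq_iff forall_8 f4_nth(1,2,4-) f4_nth(3)[of 1 y "f4 1 x y"]
        f4_nth(3)[of 1 x "f4 1 y (f4 1 x y)"] T
    by (simp_all add: algebra_simps)
  ultimately have "x $ 1 * y $ 1 = 0" "x $ 2 * y $ 2 = 0" "x $ 1 * y $ 2 + x $ 2 * y $ 1 = 0"
    by simp_all
  from symmetric_product_eq_0[OF this] have "D = 0"
    by (auto simp: D_def)
  with \<open>D \<noteq> 0\<close> show False by contradiction
qed

text \<open>Put \<open>T = [x, y]\<close> and let \<open>D\<close> be the determinant of the first two coordinates of \<open>x\<close> and \<open>y\<close>.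
  For \<open>D \<noteq> 0\<close> the sixth coordinate of \<open>[x, [y, T]] = 0\<close> makes these coordinates orthogonal, and
  with this the seventh and the eighth say that their symmetric product vanishes, which
  contradicts \<open>D \<noteq> 0\<close>. For \<open>D = 0\<close> the double brackets live in the last two coordinates only and
  cannot be equal and nonzero.\<close>
lemma not_has_conformal_generators_f8: "\<not> has_conformal_generators f8"
proof
  assume "has_conformal_generators f8"
  then obtain x y where 1: "f8 x (f8 y (f8 x y)) = 0"
    and 2: "f8 x (f8 x (f8 x y)) = f8 y (f8 y (f8 x y))"
    and 3: "f8 x (f8 x (f8 x y)) \<noteq> 0"
    unfolding has_conformal_generators_def by blast
  define T where "T = f8 x y"
  define D where "D = x $ 1 * y $ 2 - x $ 2 * y $ 1"
  have T: "T $ 1 = 0" "T $ 2 = 0" "T $ 3 = - D" "T $ 4 = x $ 3 * y $ 1 - x $ 1 * y $ 3"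
    "T $ 5 = x $ 3 * y $ 2 - x $ 2 * y $ 3"
    by (simp_all add: T_def f8_nth D_def)
  have YT: "f8 v T $ 1 = 0" "f8 v T $ 2 = 0" "f8 v T $ 3 = 0" "f8 v T $ 4 = v $ 1 * D"
    "f8 v T $ 5 = v $ 2 * D" "f8 v T $ 6 = - (v $ 1 * T $ 4 + v $ 2 * T $ 5)" for v
    by (simp_all add: f8_nth T(1-3))
  define q where "q v = v $ 1 * T $ 4 + v $ 2 * T $ 5" for v :: "real ^ 8"
  have WYT: "f8 w (f8 v T) $ 6 = - D * (w $ 1 * v $ 1 + w $ 2 * v $ 2)"
    "f8 w (f8 v T) $ 7 = - D * (2 * w $ 1 * v $ 1 + w $ 3 * v $ 1) - w $ 2 * q v"
    "f8 w (f8 v T) $ 8 = - D * (w $ 1 * v $ 2 + w $ 2 * v $ 1 + w $ 3 * v $ 2) + w $ 1 * q v"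
    "f8 w (f8 v T) $ 1 = 0" "f8 w (f8 v T) $ 2 = 0" "f8 w (f8 v T) $ 3 = 0"
    "f8 w (f8 v T) $ 4 = 0" "f8 w (f8 v T) $ 5 = 0" for v w
    by (simp_all add: f8_nth(6)[of w "f8 v T"] f8_nth(7)[of w "f8 v T"] f8_nth(8)[of w "f8 v T"]
        f8_nth(1-5)[of w "f8 v T"] YT q_def algebra_simps)
  note 1 = 1[folded T_def, unfolded vec_eq_iff forall_8 WYT]
  note 2 = 2[folded T_def, unfolded vec_eq_iff forall_8 WYT]
  note 3 = 3[folded T_def, unfolded vec_eq_iff forall_8 WYT]
  show False
  proof (cases "D = 0")
    case True
    then show False
      using 1 2 3 by auto
  next
    case False
    let ?N = "(y $ 1)\<^sup>2 + (y $ 2)\<^sup>2"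
    have dot: "x $ 1 * y $ 1 + x $ 2 * y $ 2 = 0"
      using 1 False by simp
    have q: "q y = x $ 3 * ?N"
      using dot unfolding q_def T by algebra
    have Dy: "D * y $ 1 = - x $ 2 * ?N" "D * y $ 2 = x $ 1 * ?N"
      using dot unfolding D_def by algebra+
    have e1: "- D * (2 * x $ 1 * y $ 1 + x $ 3 * y $ 1) - x $ 2 * q y = 0"
      "- D * (x $ 1 * y $ 2 + x $ 2 * y $ 1 + x $ 3 * y $ 2) + x $ 1 * q y = 0"
      using 1 by simp_all
    have "D * (x $ 1 * y $ 1) = 0" "D * (x $ 1 * y $ 2 + x $ 2 * y $ 1) = 0"
      using e1 q Dy by algebra+
    then have "x $ 1 * y $ 1 = 0" "x $ 2 * y $ 2 = 0" "x $ 1 * y $ 2 + x $ 2 * y $ 1 = 0"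
      using False dot by auto
    from symmetric_product_eq_0[OF this] have "D = 0"
      by (auto simp: D_def)
    with False show False by contradiction
  qed
qed

text \<open>The nilpotency step separates \<open>{f1, f3, f4 0, f5 0, f5 1, f7}\<close>, \<open>{f2, f4 1}\<close> and
  \<open>{f6, f8}\<close>. Conformal generators exist in \<open>f2\<close> and \<open>f6\<close> but not in \<open>f4 1\<close> and \<open>f8\<close>. In the first
  group, \<open>f1\<close>, \<open>f3\<close> and \<open>f4 0\<close> have an active centraliser and the other three do not; in each of
  these two triples, in the order in which they are listed, the first algebra has a commuting conformal
  pair, the second has only non-commuting ones, and the third has none.\<close>
lemma wnn_algebras_distinguished:
  assumes "f \<in> wnn_algebras" "f' \<in> wnn_algebras" "bracket_invariants f = bracket_invariants f'"
  shows "f = f'"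
proof -
  note evaluated = three_step_f1 three_step_f3 three_step_f4_0 three_step_f5[of 0]
      three_step_f5[of 1] three_step_f7
    not_three_step_f2 not_three_step_f4_1 not_four_step_imp_not_three_step[OF not_four_step_f6]
        not_four_step_imp_not_three_step[OF not_four_step_f8]
    four_step_f2 four_step_f4_1 not_four_step_f6 not_four_step_f8
    has_conformal_generators_f2 not_has_conformal_generators_f4_1 has_conformal_generators_f6
        not_has_conformal_generators_f8
    has_active_centraliser_f1 has_active_centraliser_f3 has_active_centraliser_f4_0
        not_has_active_centraliser_f5[of 0] not_has_active_centraliser_f5[of 1]
        not_has_active_centraliser_f7
    has_commuting_conformal_pair_f1 has_commuting_conformal_pair_f5_0
        not_has_commuting_conformal_pair_f3 not_has_commuting_conformal_pair_f5_1
    has_conformal_pair_f3 has_conformal_pair_f5_1 not_has_conformal_pair_f4_0 not_has_conformal_pair_f7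
    has_commuting_conformal_pair_imp_has_conformal_pair[OF has_commuting_conformal_pair_f1]
        has_commuting_conformal_pair_imp_has_conformal_pair[OF has_commuting_conformal_pair_f5_0]
  show ?thesis
    using assms unfolding wnn_algebras_def
    by (elim insertE emptyE) (simp_all add: bracket_invariants_def evaluated)
qed

section \<open>A family of models\<close>

text \<open>The coordinates belong to a basis \<open>Y, J Y, u, J u, S, T, w, J w\<close> with the brackets
  \<open>[T, Y] = u\<close>, \<open>[T, J Y] = J u\<close>, \<open>[Y, u] = S\<close>, \<open>[Y, J u] = [J Y, u] = \<alpha> w\<close>,
  \<open>[J Y, J u] = S + 2 \<i> \<alpha> w\<close>, \<open>[Y, J Y] = \<epsilon> T + \<beta> w\<close>, \<open>[u, T] = s w\<close>, \<open>[J u, T] = s J w\<close>,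
  \<open>[S, Y] = \<epsilon> s J w\<close>, \<open>[S, J Y] = - \<epsilon> s w\<close>, where \<open>\<alpha> = a1 + \<i> a2\<close>, \<open>\<beta> = b1 + \<i> b2\<close> and
  \<open>\<i>\<close> acts on \<open>w\<close> as \<open>J\<close>. The elements \<open>S = \<gamma> z\<close> and \<open>T = J z\<close> of an adapted frame satisfy
  \<open>J S = \<gamma> T\<close>, so \<open>\<gamma>\<close> is visible in \<open>J\<close> but not in the bracket.\<close>
definition model :: "real \<Rightarrow> real \<Rightarrow> real \<Rightarrow> real \<Rightarrow> real \<Rightarrow> real \<Rightarrow> real ^ 8 \<Rightarrow> real ^ 8 \<Rightarrow> real ^ 8" where
  "model \<epsilon> s a1 a2 b1 b2 = structure_eqs (\<lambda>e. [0, 0, e 1 6, e 2 6, - (e 1 3 + e 2 4), - \<epsilon> * e 1 2,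
     - (b1 * e 1 2 + a1 * (e 1 4 + e 2 3) - 2 * a2 * e 2 4 + s * e 3 6 - \<epsilon> * s * e 5 2),
     - (b2 * e 1 2 + a2 * (e 1 4 + e 2 3) + 2 * a1 * e 2 4 + s * e 4 6 + \<epsilon> * s * e 5 1)])"

lemma lie_isomorphic_R8I:
  fixes \<phi> :: "real ^ 8 \<Rightarrow> real ^ 8"
  assumes "linear \<phi>" "\<And>v. \<phi> v = 0 \<Longrightarrow> v = 0" "\<And>x y. \<phi> (br x y) = br' (\<phi> x) (\<phi> y)"
  shows "lie_isomorphic br br'"
proof -
  have "inj \<phi>"
    using assms(1,2) by (simp add: linear_injective_0)
  then have "bij \<phi>"
    using linear_injective_imp_surjective[OF assms(1)] by (simp add: bij_def)
  then show ?thesis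
    unfolding lie_isomorphic_def using assms by blast
qed

text \<open>In the following maps the vector on the right lists the coordinates, in the basis of the
  model, of \<open>v\<^sub>1 E\<^sub>1 + \<dots> + v\<^sub>8 E\<^sub>8\<close> for elements \<open>E\<^sub>k\<close> whose brackets are those of the \<open>e\<^sub>k\<close> without
  the sign of the Chevalley-Eilenberg differential; the minus sign in front corrects for it. Once
  \<open>E\<^sub>1, E\<^sub>2, E\<^sub>3\<close> are chosen, all elements that are brackets are forced. If \<open>\<epsilon> = 1\<close>, the element
  \<open>E\<^sub>3 = [Y, J Y] = T + \<beta> w\<close> absorbs \<open>\<beta>\<close>.\<close>
lemma model_f1: "lie_isomorphic f1 (model 0 0 0 0 0 0)"
  by (rule lie_isomorphic_R8I[where \<phi> = "\<lambda>v. - vector [v $ 1, v $ 3, v $ 4, -v $ 5, v $ 6, -v $ 2,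
      v $ 7, v $ 8]"];
      simp add: linear_iff f1_def model_def coord_simps algebra_simps; auto?)

lemma model_f2: "lie_isomorphic f2 (model 1 0 0 0 b1 b2)"
  by (rule lie_isomorphic_R8I[where \<phi> = "\<lambda>v. - vector [v $ 1, v $ 2, -v $ 4, -v $ 5, -v $ 6, v $ 3,
      b1 * v $ 3 + v $ 7, b2 * v $ 3 + v $ 8]"];
      simp add: linear_iff f2_def model_def coord_simps algebra_simps; auto?)

lemma model_f3: "lie_isomorphic f3 (model 0 0 0 0 1 0)"
  by (rule lie_isomorphic_R8I[where \<phi> = "\<lambda>v. - vector [v $ 1, v $ 2, v $ 5, v $ 6, v $ 7, -v $ 3,
      v $ 4, v $ 8]"];
      simp add: linear_iff f3_def model_def coord_simps algebra_simps; auto?)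

lemma model_f4_1: "lie_isomorphic (f4 1) (model 1 0 1 0 b1 b2)"
  by (rule lie_isomorphic_R8I[where \<phi> = "\<lambda>v. - vector [v $ 1, v $ 2, -v $ 4, -v $ 6,
      -v $ 5 - v $ 7, v $ 3, b1 * v $ 3 - v $ 8, b2 * v $ 3 - 2 * v $ 7]"];
      simp add: linear_iff f4_def model_def coord_simps algebra_simps; auto?)

text \<open>Here the shifts \<open>E\<^sub>1 = Y + (b2/2) J u\<close> and \<open>E\<^sub>2 = J Y + (b2/2) u - b1 J u\<close> make \<open>E\<^sub>1\<close> and \<open>E\<^sub>2\<close>
  commute.\<close>
lemma model_f4_0: "lie_isomorphic (f4 0) (model 0 0 1 0 b1 b2)"
  by (rule lie_isomorphic_R8I[where \<phi> = "\<lambda>v. - vector [v $ 1, v $ 2, b2/2 * v $ 2 - v $ 4,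
      b2/2 * v $ 1 - b1 * v $ 2 - v $ 6, -v $ 5 - v $ 7, v $ 3, -v $ 8, -2 * v $ 7]"];
      simp add: linear_iff f4_def model_def coord_simps algebra_simps; auto?)

lemma model_f5_0: "lie_isomorphic (f5 0) (model 0 1 0 0 0 0)"
  by (rule lie_isomorphic_R8I[where \<phi> = "\<lambda>v. - vector [v $ 1, v $ 2, v $ 4, v $ 5, v $ 8, -v $ 3,
      v $ 6, v $ 7]"];
      simp add: linear_iff f5_def model_def coord_simps algebra_simps; auto?)

lemma model_f6: "lie_isomorphic f6 (model 1 1 0 0 b1 b2)"
  by (rule lie_isomorphic_R8I[where \<phi> = "\<lambda>v. - vector [v $ 1, v $ 2, -v $ 4, -v $ 5, -v $ 6, v $ 3,
      b1 * v $ 3 - v $ 8, b2 * v $ 3 + v $ 7]"];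
      simp add: linear_iff f6_def model_def coord_simps algebra_simps; auto?)

lemma rotation_eq_0:
  fixes p q x y :: real
  assumes "p * x = q * y" "q * x + p * y = 0" "p \<noteq> 0 \<or> q \<noteq> 0"
  shows "x = 0 \<and> y = 0"
proof -
  have "(p\<^sup>2 + q\<^sup>2) * x = 0"
    using assms(1,2) by algebra
  moreover have "(p\<^sup>2 + q\<^sup>2) * y = 0"
    using assms(1,2) by algebra
  moreover have "p\<^sup>2 + q\<^sup>2 \<noteq> 0"
    using assms(3) by (auto simp: sum_power2_eq_zero_iff)
  ultimately show ?thesis by auto
qed

text \<open>The frame is rotated: \<open>E\<^sub>1 = \<mu> Y\<close> and \<open>E\<^sub>2 = \<i> \<mu> Y\<close> with \<open>\<mu> = p + \<i> q\<close>, and \<open>E\<^sub>3 = - t T\<close>.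
  Then \<open>[E\<^sub>1, E\<^sub>2] = \<bar>\<mu>\<bar>\<^sup>2 \<beta> w\<close> has to be half of \<open>E\<^sub>7 = \<i> t\<^sup>2 \<mu> w\<close>. With \<open>m = \<bar>\<beta>\<bar>\<^sup>2\<close> this is solved
  by \<open>\<mu> = - 2 \<i> m \<beta>\<close> and \<open>t = 2 m\<close>, a choice that avoids divisions and roots.\<close>
lemma model_f5_1:
  assumes "b1 \<noteq> 0 \<or> b2 \<noteq> 0"
  shows "lie_isomorphic (f5 1) (model 0 1 0 0 b1 b2)"
proof -
  define m where "m = b1^2 + b2^2"
  define p where "p = 2 * m * b2"
  define q where "q = - 2 * m * b1"
  define t where "t = 2 * m"
  have "m \<noteq> 0"
    using assms by (auto simp: m_def sum_power2_eq_zero_iff)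
  then have nz: "t \<noteq> 0" "p^2 + q^2 \<noteq> 0" and pq: "p \<noteq> 0 \<or> q \<noteq> 0"
    using assms by (auto simp: t_def p_def q_def sum_power2_eq_zero_iff)
  note rot = rotation_eq_0[OF _ _ pq]
  let ?f = "\<lambda>v::real^8. - vector [p * v $ 1 - q * v $ 2, q * v $ 1 + p * v $ 2,
      t * (p * v $ 4 - q * v $ 5), t * (q * v $ 4 + p * v $ 5), t * (p^2 + q^2) * v $ 8,
      -t * v $ 3, t^2 * (p * v $ 6 - q * v $ 7), t^2 * (q * v $ 6 + p * v $ 7)] :: real^8"
  show ?thesis
  proof (rule lie_isomorphic_R8I[where \<phi> = ?f])
    show "linear ?f" by (simp add: linear_iff coord_simps algebra_simps)
    show "v = 0" if "?f v = 0" for v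
    proof -
      have "v $ 1 = 0 \<and> v $ 2 = 0"
        using that rot[of "v $ 1" "v $ 2"] by (simp add: coord_simps)
      moreover have "v $ 4 = 0 \<and> v $ 5 = 0"
        using that rot[of "v $ 4" "v $ 5"] nz calculation by (simp add: coord_simps)
      moreover have "v $ 6 = 0 \<and> v $ 7 = 0"
        using that rot[of "v $ 6" "v $ 7"] nz by (simp add: coord_simps)
      ultimately show ?thesis
        using that nz pq by (auto simp add: coord_simps)
    qed
    show "?f (f5 1 x y) = model 0 1 0 0 b1 b2 (?f x) (?f y)" for x y
      unfolding p_def q_def t_def m_def
      by (simp add: f5_def model_def coord_simps; (intro conjI)?; algebra)
  qed
qed

text \<open>With \<open>E\<^sub>1 = \<mu> Y + \<kappa> u\<close>, \<open>E\<^sub>2 = \<i> \<mu> Y - \<i> \<kappa> u\<close>, \<open>E\<^sub>3 = - n T\<close> the bracket of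
  \<open>E\<^sub>1\<close> and \<open>E\<^sub>4\<close> minus that of \<open>E\<^sub>2\<close> and \<open>E\<^sub>5\<close> is \<open>- 2 \<i> n \<alpha> \<mu>\<^sup>2 w\<close> and has to be twice \<open>[E\<^sub>3, E\<^sub>4] = n\<^sup>2 \<mu> w\<close>. This holds for
  \<open>\<mu> = \<i> \<alpha>\<^sup>*\<close> and \<open>n = \<bar>\<alpha>\<bar>\<^sup>2\<close>, where \<open>\<alpha>\<^sup>*\<close> is the conjugate.
  Finally \<open>[E\<^sub>1, E\<^sub>2] = 0\<close> forces \<open>\<kappa> = - \<i> \<beta> / 2\<close>.
  In the proof \<open>\<mu> = p + \<i> q\<close> and \<open>\<kappa> = k + \<i> l\<close>.\<close>
lemma model_f7:
  assumes "a1 \<noteq> 0 \<or> a2 \<noteq> 0"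
  shows "lie_isomorphic f7 (model 0 1 a1 a2 b1 b2)"
proof -
  define n where "n = a1^2 + a2^2"
  define p where "p = a2"
  define q where "q = a1"
  define k where "k = b2 / 2"
  define l where "l = - b1 / 2"
  have nz: "n \<noteq> 0" and pq: "p \<noteq> 0 \<or> q \<noteq> 0"
    using assms by (auto simp: n_def p_def q_def sum_power2_eq_zero_iff)
  note rot = rotation_eq_0[OF _ _ pq]
  let ?f = "\<lambda>v::real^8. - vector [p * v $ 1 - q * v $ 2, q * v $ 1 + p * v $ 2,
      k * v $ 1 + l * v $ 2 + n * (p * v $ 4 - q * v $ 5),
      l * v $ 1 - k * v $ 2 + n * (q * v $ 4 + p * v $ 5), n^2 * v $ 6, -n * v $ 3,
      -n * (k * v $ 4 + l * v $ 5) - 2 * a2 * n^2 * v $ 6 + n^2 * (p * v $ 7 - q * v $ 8),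
      -n * (l * v $ 4 - k * v $ 5) + n^2 * (q * v $ 7 + p * v $ 8)] :: real^8"
  show ?thesis
  proof (rule lie_isomorphic_R8I[where \<phi> = ?f])
    show "linear ?f" by (simp add: linear_iff coord_simps algebra_simps)
    show "v = 0" if "?f v = 0" for v
    proof -
      have "v $ 1 = 0 \<and> v $ 2 = 0"
        using that rot[of "v $ 1" "v $ 2"] by (simp add: coord_simps)
      moreover have "v $ 4 = 0 \<and> v $ 5 = 0"
        using that rot[of "v $ 4" "v $ 5"] nz calculation by (simp add: coord_simps)
      moreover have "v $ 6 = 0"
        using that nz calculation by (simp add: coord_simps)
      ultimately show ?thesis
        using that rot[of "v $ 7" "v $ 8"] nz by (auto simp add: coord_simps)
    qed
    show "?f (f7 x y) = model 0 1 a1 a2 b1 b2 (?f x) (?f y)" for x y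
      unfolding p_def q_def n_def k_def l_def
      by (simp add: f7_def model_def coord_simps; (intro conjI)?; algebra)
  qed
qed

text \<open>The same comparison as for \<open>f7\<close>, now with \<open>E\<^sub>3 = [E\<^sub>1, E\<^sub>2] = n (T + \<beta> w)\<close>, leads to
  \<open>\<mu> = - \<i> \<alpha>\<^sup>*\<close> and \<open>n = \<bar>\<alpha>\<bar>\<^sup>2\<close>.\<close>
lemma model_f8:
  assumes "a1 \<noteq> 0 \<or> a2 \<noteq> 0"
  shows "lie_isomorphic f8 (model 1 1 a1 a2 b1 b2)"
proof -
  define n where "n = a1^2 + a2^2"
  define p where "p = - a2"
  define q where "q = - a1"
  have nz: "n \<noteq> 0" and pq: "p \<noteq> 0 \<or> q \<noteq> 0"
    using assms by (auto simp: n_def p_def q_def sum_power2_eq_zero_iff)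
  note rot = rotation_eq_0[OF _ _ pq]
  let ?f = "\<lambda>v::real^8. - vector [p * v $ 1 - q * v $ 2, q * v $ 1 + p * v $ 2,
      -n * (p * v $ 4 - q * v $ 5), -n * (q * v $ 4 + p * v $ 5), -(n^2) * v $ 6, n * v $ 3,
      n * b1 * v $ 3 + 2 * a2 * n^2 * v $ 6 + n^2 * (p * v $ 7 - q * v $ 8),
      n * b2 * v $ 3 + n^2 * (q * v $ 7 + p * v $ 8)] :: real^8"
  show ?thesis
  proof (rule lie_isomorphic_R8I[where \<phi> = ?f])
    show "linear ?f" by (simp add: linear_iff coord_simps algebra_simps)
    show "v = 0" if "?f v = 0" for v
    proof -
      have "v $ 1 = 0 \<and> v $ 2 = 0"
        using that rot[of "v $ 1" "v $ 2"] by (simp add: coord_simps)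
      moreover have "v $ 4 = 0 \<and> v $ 5 = 0"
        using that rot[of "v $ 4" "v $ 5"] nz calculation by (simp add: coord_simps)
      moreover have "v $ 6 = 0"
        using that nz calculation by (simp add: coord_simps)
      ultimately show ?thesis
        using that rot[of "v $ 7" "v $ 8"] nz by (auto simp add: coord_simps)
    qed
    show "?f (f8 x y) = model 1 1 a1 a2 b1 b2 (?f x) (?f y)" for x y
      unfolding p_def q_def n_def
      by (simp add: f8_def model_def coord_simps; (intro conjI)?; algebra)
  qed
qed

text \<open>The case \<open>\<gamma> = 1\<close>, that is \<open>J S = T\<close>.\<close>
definition model_J :: "real ^ 8 \<Rightarrow> real ^ 8" where
  "model_J v = vector [- v $ 2, v $ 1, - v $ 4, v $ 3, - v $ 6, v $ 5, - v $ 8, v $ 7]"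

lemma model_complex: "complex_structure (model \<epsilon> s a1 a2 b1 b2) model_J"
  unfolding complex_structure_def linear_iff
  by (simp add: model_def model_J_def coord_simps algebra_simps)

text \<open>Modulo the span of \<open>w\<close> and \<open>J w\<close> the model has no central plane that is invariant under \<open>J\<close>,
  so the series is constant from the first step on.\<close>
lemma asc_series_model:
  "asc_series (model \<epsilon> s a1 a2 b1 b2) model_J (Suc k) =
     {x. x $ 1 = 0 \<and> x $ 2 = 0 \<and> x $ 3 = 0 \<and> x $ 4 = 0 \<and> x $ 5 = 0 \<and> x $ 6 = 0}"
proof -
  let ?M = "model \<epsilon> s a1 a2 b1 b2"
  let ?V = "{x :: real ^ 8. x $ 1 = 0 \<and> x $ 2 = 0 \<and> x $ 3 = 0 \<and> x $ 4 = 0 \<and> x $ 5 = 0 \<and> x $ 6 = 0}"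
  have step: "{x. (\<forall>y. ?M x y \<in> S) \<and> (\<forall>y. ?M (model_J x) y \<in> S)} = ?V"
    if S: "0 \<in> S" "S \<subseteq> ?V" for S
  proof (intro equalityI subsetI)
    fix x assume "x \<in> {x. (\<forall>y. ?M x y \<in> S) \<and> (\<forall>y. ?M (model_J x) y \<in> S)}"
    then have *: "?M x y \<in> ?V" "?M (model_J x) y \<in> ?V" for y
      using S(2) by blast+
    show "x \<in> ?V"
      using *(1)[of "unit8 1"] *(1)[of "unit8 2"] *(1)[of "unit8 6"] *(2)[of "unit8 1"]
      by (simp add: model_def model_J_def coord_simps)
  next
    fix x assume "x \<in> ?V"
    then have "?M x y = 0" "?M (model_J x) y = 0" for y
      by (simp_all add: model_def model_J_def coord_simps)
    then show "x \<in> {x. (\<forall>y. ?M x y \<in> S) \<and> (\<forall>y. ?M (model_J x) y \<in> S)}"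
      using S(1) by simp
  qed
  show ?thesis
  proof (induction k)
    case 0
    show ?case
      unfolding asc_series.simps by (rule step) auto
  next
    case (Suc k)
    show ?case
      unfolding asc_series.simps(2)[of _ _ "Suc k"] Suc by (rule step) auto
  qed
qed

lemma model_wnn: "weakly_non_nilpotent (model \<epsilon> s a1 a2 b1 b2) model_J"
proof -
  let ?a = "asc_series (model \<epsilon> s a1 a2 b1 b2) model_J"
  have const: "?a 1 = ?a (1 + l)" for l
    by (simp only: One_nat_def add_Suc add_0 asc_series_model)
  have "unit8 7 \<in> ?a 1" "unit8 7 \<noteq> 0" "unit8 1 \<notin> ?a 1"
    unfolding One_nat_def asc_series_model by (simp_all add: vec_eq_iff)
  then have "?a 1 \<noteq> {0}" "?a 1 \<noteq> UNIV"
    by (blast, blast)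
  then show ?thesis
    unfolding weakly_non_nilpotent_def using const by (intro conjI exI[of _ 1] allI impI zero_less_one)
qed

text \<open>Each of the ten algebras occurs in the family, for any values of the parameters that the
  identifications above allow.\<close>
lemma isomorphic_imp_wnn:
  assumes "f \<in> wnn_algebras" "lie_isomorphic br f"
  shows "\<exists>J. complex_structure br J \<and> weakly_non_nilpotent br J"
proof -
  have f5_1: "lie_isomorphic (f5 1) (model 0 1 0 0 1 0)"
    and f7: "lie_isomorphic f7 (model 0 1 1 0 b1 b2)"
    and f8: "lie_isomorphic f8 (model 1 1 1 0 b1 b2)" for b1 b2
    by (rule model_f5_1 model_f7 model_f8; simp)+
  have "\<exists>\<epsilon> s a1 a2 b1 b2. lie_isomorphic f (model \<epsilon> s a1 a2 b1 b2)"
    using assms(1) unfolding wnn_algebras_def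
    by (elim insertE emptyE) ((hypsubst, intro exI,
        rule model_f1 model_f2 model_f3 model_f4_0 model_f4_1 model_f5_0 f5_1 model_f6 f7 f8)+)
  then show ?thesis
    using wnn_transfer[OF lie_isomorphic_trans[OF assms(2)] model_complex model_wnn] by blast
qed

section \<open>Ideals with a strongly non-nilpotent quotient\<close>

lemma span_independent_eq_UNIV:
  fixes B :: "'a::real_vector set"
  assumes "independent B" "card B = dim (UNIV :: 'a set)" "dim (UNIV :: 'a set) \<noteq> 0"
  shows "span B = UNIV"
proof (rule ccontr)
  assume "span B \<noteq> UNIV"
  then obtain x where x: "x \<notin> span B" by blast
  obtain C :: "'a set" where C: "independent C" "UNIV \<subseteq> span C" "card C = dim (UNIV :: 'a set)"
    using basis_exists[of "UNIV :: 'a set"] by metis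
  have fin: "finite C" "finite B"
    using assms C(3) card.infinite by metis+
  have "independent (insert x B)"
    using assms(1) x by (simp add: independent_insert)
  then have "card (insert x B) \<le> card C"
    using independent_span_bound[OF fin(1), of "insert x B"] C(2) by blast
  moreover have "x \<notin> B"
    using x span_base by blast
  ultimately show False
    using fin assms(2) C(3) by simp
qed

lemma surj_if_inj_dim_8:
  fixes f :: "real ^ 8 \<Rightarrow> 'a::real_vector"
  assumes f: "linear f" "inj f" and dim: "dim (UNIV :: 'a set) = 8"
  shows "surj f"
proof -
  have "independent (f ` Basis)"
    using linear_independent_injective_image[OF f(1) independent_Basis] f(2)
    by (simp add: inj_on_subset)
  moreover have "card (f ` Basis) = 8"
    using card_image[of f Basis] f(2) by (simp add: inj_on_subset)
  ultimately have "span (f ` Basis) = UNIV"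
    using dim by (intro span_independent_eq_UNIV) auto
  then show ?thesis
    using linear_span_image[OF f(1), of Basis] by simp
qed

lemma lower_central_Suc_subset: "lower_central br (Suc k) \<subseteq> lower_central br k"
proof (induction k)
  case 0
  then show ?case by simp
next
  case (Suc k)
  show ?case
    using Suc by (simp only: lower_central.simps(2)[of br "Suc k"] lower_central.simps(2)[of br k])
      (rule span_mono, auto)
qed

lemma lower_central_mono: "i \<le> j \<Longrightarrow> lower_central br j \<subseteq> lower_central br i"
  by (rule lift_Suc_antimono_le[of "lower_central br"]) (rule lower_central_Suc_subset)

lemma br_mem_lower_central: "y \<in> lower_central br k \<Longrightarrow> br x y \<in> lower_central br (Suc k)"
  by (auto intro: span_base)

lemma subspace_lower_central: "subspace (lower_central br k)"
  by (cases k) simp_all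

context lie_algebra
begin

lemmas br_simps [simp] = bilinear_ladd[OF bilinear_br] bilinear_radd[OF bilinear_br]
  bilinear_lmul[OF bilinear_br] bilinear_rmul[OF bilinear_br] bilinear_lneg[OF bilinear_br]
  bilinear_rneg[OF bilinear_br] bilinear_lsub[OF bilinear_br] bilinear_rsub[OF bilinear_br]
  bilinear_lzero[OF bilinear_br] bilinear_rzero[OF bilinear_br] alternating

lemma br_antisym: "br x y = - br y x"
proof -
  have "br (x + y) (x + y) = br x x + br x y + (br y x + br y y)"
    by (simp add: bilinear_ladd[OF bilinear_br] bilinear_radd[OF bilinear_br] del: alternating)
  then have "br x y + br y x = 0"
    by (simp add: alternating)
  then show ?thesis
    by (simp add: eq_neg_iff_add_eq_0)
qed

lemma leibniz: "br x (br y w) = br (br x y) w + br y (br x w)"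
  using jacobi[of x y w] unfolding br_antisym[of w "br x y"] br_antisym[of w x]
  by (simp add: algebra_simps)

lemma br_mem_lower_central_left:
  "x \<in> lower_central br k \<Longrightarrow> br x y \<in> lower_central br (Suc k)"
  using subspace_neg[OF subspace_lower_central br_mem_lower_central, of x br k y] br_antisym[of x y]
  by simp

text \<open>The form in which nilpotency is used throughout: a set that reproduces itself by brackets
  modulo an ideal \<open>I\<close> lies in every term of the lower central series modulo \<open>I\<close>, hence in \<open>I\<close>.\<close>
lemma nilpotent_absorb:
  assumes nil: "nilpotent br" and I: "subspace I" "\<And>x y. y \<in> I \<Longrightarrow> br x y \<in> I"
    and V: "\<And>v. v \<in> V \<Longrightarrow> v \<in> span ({br x v' | x v'. v' \<in> V} \<union> I)"
  shows "V \<subseteq> I"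
proof -
  have "V \<subseteq> span (lower_central br k \<union> I)" for k
  proof (induction k)
    case 0
    then show ?case by simp
  next
    case (Suc k)
    let ?S = "span (lower_central br (Suc k) \<union> I)"
    have "br x y \<in> ?S" if "y \<in> span (lower_central br k \<union> I)" for x y
    proof -
      have "subspace {y. br x y \<in> ?S}"
        by (auto simp: subspace_def intro: span_add span_scale span_zero)
      moreover have "lower_central br k \<union> I \<subseteq> {y. br x y \<in> ?S}"
        using I(2) br_mem_lower_central by (blast intro: span_base)
      ultimately show ?thesis
        using span_minimal that by blast
    qed
    then have "{br x v' | x v'. v' \<in> V} \<union> I \<subseteq> ?S"
      using Suc by (auto intro: span_base)
    then show ?case
      using V span_minimal[OF _ subspace_span] by blast
  qed
  moreover obtain k where "lower_central br k = {0}"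
    using nil by (auto simp: nilpotent_def)
  ultimately have "V \<subseteq> span ({0} \<union> I)"
    by metis
  then show ?thesis
    using I(1) by (simp add: span_eq_iff[THEN iffD2] subspace_0 insert_absorb)
qed

end

text \<open>An ideal such that \<open>J\<close> induces on the quotient a complex structure without invariant central
  planes. The stable term of the ascending series is the example in mind. All
  calculations in the quotient are done with representatives and the congruence \<open>\<doteq>\<close> modulo \<open>A\<close>.\<close>
locale saturated_ideal = lie_algebra br
  for br :: "'a::real_vector \<Rightarrow> 'a \<Rightarrow> 'a" +
  fixes J :: "'a \<Rightarrow> 'a" and A :: "'a set"
  assumes nilpotent: "nilpotent br"
    and complex: "complex_structure br J"
    and A_subspace: "subspace A"
    and J_A: "x \<in> A \<Longrightarrow> J x \<in> A"
    and br_A: "y \<in> A \<Longrightarrow> br x y \<in> A"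
    and A_saturated: "(\<And>y. br x y \<in> A) \<Longrightarrow> (\<And>y. br (J x) y \<in> A) \<Longrightarrow> x \<in> A"
    and A_proper: "A \<noteq> UNIV"
begin

lemma linear_J: "linear J" and J_J [simp]: "J (J x) = - x"
  and integrable: "br x y + J (br (J x) y) + J (br x (J y)) - br (J x) (J y) = 0"
  using complex by (auto simp: complex_structure_def)

lemmas J_simps [simp] = linear_add[OF linear_J] linear_scale[OF linear_J] linear_diff[OF linear_J]
  linear_neg[OF linear_J] linear_0[OF linear_J]

lemma br_J_J: "br (J x) (J y) = br x y + J (br (J x) y) + J (br x (J y))"
  using integrable[of x y] by (simp add: algebra_simps)

lemma A_simps [simp, intro]:
  "0 \<in> A" "x \<in> A \<Longrightarrow> y \<in> A \<Longrightarrow> x + y \<in> A" "x \<in> A \<Longrightarrow> y \<in> A \<Longrightarrow> x - y \<in> A"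
  "x \<in> A \<Longrightarrow> r *\<^sub>R x \<in> A" "x \<in> A \<Longrightarrow> - x \<in> A"
  using A_subspace by (auto intro: subspace_0 subspace_add subspace_diff subspace_scale subspace_neg)

lemma br_A_left: "x \<in> A \<Longrightarrow> br x y \<in> A"
  using br_A br_antisym A_simps(5) by metis

text \<open>Multiplication by complex numbers, with \<open>J\<close> as multiplication by \<open>\<i>\<close>.\<close>
definition cscale :: "complex \<Rightarrow> 'a \<Rightarrow> 'a" where
  "cscale c x = Re c *\<^sub>R x + Im c *\<^sub>R J x"

lemma cscale_simps [simp]:
  "cscale c (x + y) = cscale c x + cscale c y" "cscale c (x - y) = cscale c x - cscale c y"
      "cscale c (- x) = - cscale c x"
  "cscale c (r *\<^sub>R x) = r *\<^sub>R cscale c x" "cscale c 0 = 0" "cscale 0 x = 0" "cscale 1 x = x"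
      "cscale \<i> x = J x"
  "cscale (- c) x = - cscale c x" "cscale (of_real r) x = r *\<^sub>R x" "J (cscale c x) = cscale c (J x)"
  by (simp_all add: cscale_def algebra_simps)

lemma cscale_add: "cscale (c + d) x = cscale c x + cscale d x"
  and cscale_mult: "cscale (c * d) x = cscale c (cscale d x)"
  by (simp_all add: cscale_def algebra_simps)

lemma cscale_A [simp, intro]: "x \<in> A \<Longrightarrow> cscale c x \<in> A"
  by (simp add: cscale_def J_A)

lemma cscale_A_D: "cscale c x \<in> A \<Longrightarrow> c = 0 \<or> x \<in> A"
  using cscale_A[of "cscale c x" "inverse c"] cscale_mult[of "inverse c" c x]
  by (cases "c = 0") (simp_all del: cscale_A)

definition mod_eq (infix "\<doteq>" 50) where "x \<doteq> y \<longleftrightarrow> x - y \<in> A"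

lemma mod_eq_refl [simp]: "x \<doteq> x"
  by (simp add: mod_eq_def)

lemma mod_eq_sym: "x \<doteq> y \<Longrightarrow> y \<doteq> x"
  using A_simps(5)[of "x - y"] by (simp add: mod_eq_def)

lemma mod_eq_trans [trans]: "x \<doteq> y \<Longrightarrow> y \<doteq> z \<Longrightarrow> x \<doteq> z"
  using A_simps(2)[of "x - y" "y - z"] by (simp add: mod_eq_def)

lemma mod_eq_mem: "x \<doteq> y \<Longrightarrow> x \<in> A \<longleftrightarrow> y \<in> A"
  using A_simps(2)[of "x - y" y] A_simps(3)[of x "x - y"] by (auto simp: mod_eq_def)

lemma mod_eq_0: "x \<doteq> 0 \<longleftrightarrow> x \<in> A"
  by (simp add: mod_eq_def)

lemma mod_eq_add: "x \<doteq> y \<Longrightarrow> x' \<doteq> y' \<Longrightarrow> x + x' \<doteq> y + y'"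
  using A_simps(2)[of "x - y" "x' - y'"] by (simp add: mod_eq_def algebra_simps)

lemma mod_eq_cs: "x \<doteq> y \<Longrightarrow> cscale c x \<doteq> cscale c y"
  using cscale_A[of "x - y" c] by (simp add: mod_eq_def)

lemma mod_eq_scale: "x \<doteq> y \<Longrightarrow> r *\<^sub>R x \<doteq> r *\<^sub>R y"
  using A_simps(4)[of "x - y" r] by (simp add: mod_eq_def algebra_simps)

lemma mod_eq_J: "x \<doteq> y \<Longrightarrow> J x \<doteq> J y"
  using J_A[of "x - y"] by (simp add: mod_eq_def)

definition central_mod :: "'a \<Rightarrow> bool" where
  "central_mod z \<longleftrightarrow> z \<notin> A \<and> (\<forall>y. br z y \<in> A)"

text \<open>For \<open>z\<close> central modulo \<open>A\<close> the terms with \<open>z\<close> drop out of the integrability condition for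
  \<open>z\<close> and \<open>y\<close>.\<close>
lemma ad_J_commutes:
  assumes "central_mod z"
  shows "br (J z) (J y) \<doteq> J (br (J z) y)"
proof -
  have "br (J z) (J y) - J (br (J z) y) = br z y + J (br z (J y))"
    by (simp add: br_J_J)
  then show ?thesis
    using assms by (simp add: mod_eq_def central_mod_def J_A)
qed

lemma ad_J_cs:
  assumes "central_mod z"
  shows "br (J z) (cscale c y) \<doteq> cscale c (br (J z) y)"
  using mod_eq_scale[OF ad_J_commutes[OF assms], of "Im c" y]
  by (simp add: cscale_def mod_eq_def)

text \<open>By complex linearity a nonzero multiple \<open>c z\<close> in the image of \<open>ad (J z)\<close> would put \<open>J z\<close> itself
  into the image, say \<open>[J z, y] = J z\<close>; then \<open>ad y\<close> is not nilpotent.\<close>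
lemma ad_J_no_fixpoint:
  assumes z: "central_mod z" and y: "br (J z) y \<doteq> cscale c z"
  shows "c = 0"
proof (rule ccontr)
  assume c: "c \<noteq> 0"
  let ?y = "cscale (\<i> / c) y"
  have "br (J z) ?y \<doteq> cscale (\<i> / c) (br (J z) y)"
    by (rule ad_J_cs[OF z])
  also have "\<dots> \<doteq> cscale (\<i> / c) (cscale c z)"
    by (rule mod_eq_cs[OF y])
  also have "\<dots> = J z"
    using c by (simp flip: cscale_mult)
  finally have *: "br ?y (J z) + J z \<in> A"
    using A_simps(5) br_antisym[of ?y] by (fastforce simp: mod_eq_def)
  have "{J z} \<subseteq> A"
  proof (rule nilpotent_absorb[OF nilpotent A_subspace br_A])
    fix v assume "v \<in> {J z}"
    then have "v = J z" by simp
    have "br ?y (J z) + J z - br ?y (J z) \<in> span ({br x v' |x v'. v' \<in> {J z}} \<union> A)"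
      by (rule span_diff) (use * in \<open>auto intro!: span_base\<close>)
    then show "v \<in> span ({br x v' |x v'. v' \<in> {J z}} \<union> A)"
      using \<open>v = J z\<close> by simp
  qed
  then have "z \<in> A"
    using J_A[of "J z"] A_simps(5)[of "- z"] by simp
  then show False
    using z by (simp add: central_mod_def)
qed

text \<open>A pair that spans, together with \<open>[J z, Y]\<close>, a three-dimensional complex space modulo \<open>A\<close>.\<close>
definition adapted :: "'a \<Rightarrow> 'a \<Rightarrow> bool" where
  "adapted z Y \<longleftrightarrow> central_mod z \<and> br (J z) Y \<notin> A \<and> br (J z) (br (J z) Y) \<in> A"

text \<open>Modulo \<open>A\<close>, start with an element on which the nilpotent map \<open>ad (J z)\<close> can be iterated as
  often as possible without reaching zero; \<open>Y\<close> is the iterate before the last nonzero one.\<close>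
lemma adapted_exists:
  assumes z: "central_mod z"
  shows "\<exists>Y. adapted z Y"
proof -
  define D where "D = br (J z)"
  obtain K where K: "lower_central br K = {0}"
    using nilpotent by (auto simp: nilpotent_def)
  have "(D ^^ n) y \<in> lower_central br n" for n y
    by (induction n) (auto simp: D_def intro: span_base)
  then have ex: "\<forall>y. (D ^^ K) y \<in> A"
    using K by (metis A_simps(1) singletonD)
  define n where "n = (LEAST n. \<forall>y. (D ^^ n) y \<in> A)"
  have n: "\<forall>y. (D ^^ n) y \<in> A" and min: "\<And>m. m < n \<Longrightarrow> \<not> (\<forall>y. (D ^^ m) y \<in> A)"
    unfolding n_def using LeastI[of "\<lambda>n. \<forall>y. (D ^^ n) y \<in> A", OF ex] not_less_Least by blast+
  have "n \<noteq> 0"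
    using n A_proper by auto
  moreover have "n \<noteq> 1"
    using n A_saturated[of z] z by (auto simp: D_def central_mod_def)
  ultimately obtain m where m: "n = Suc (Suc m)"
    by (metis One_nat_def not0_implies_Suc)
  then obtain y where "(D ^^ Suc m) y \<notin> A"
    using min[of "Suc m"] by auto
  moreover have "(D ^^ Suc (Suc m)) y \<in> A"
    using n m by metis
  ultimately have "adapted z ((D ^^ m) y)"
    using z by (simp add: adapted_def D_def)
  then show ?thesis ..
qed

text \<open>Applying \<open>ad (J z)\<close>, which kills \<open>u = [J z, Y]\<close> and \<open>z\<close>, isolates the coefficient of \<open>Y\<close>; a
  relation between \<open>u\<close> and \<open>z\<close> alone contradicts \<open>ad_J_no_fixpoint\<close>.\<close>
lemma adapted_independent:
  assumes zY: "adapted z Y" and eq: "cscale a Y + cscale b (br (J z) Y) + cscale c z \<in> A"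
  shows "a = 0 \<and> b = 0 \<and> c = 0"
proof -
  define u where "u = br (J z) Y"
  have z: "central_mod z" "z \<notin> A" and u: "u \<notin> A" "br (J z) u \<in> A"
    using zY by (auto simp: adapted_def u_def central_mod_def)
  have zJz: "br (J z) z \<in> A"
    using z(1) br_antisym[of "J z" z] A_simps(5) by (metis central_mod_def)
  have "0 \<doteq> br (J z) (cscale a Y + cscale b u + cscale c z)"
    using br_A eq by (metis mod_eq_0 mod_eq_sym u_def)
  also have "\<dots> \<doteq> cscale a u + cscale b (br (J z) u) + cscale c (br (J z) z)"
    using mod_eq_add[OF mod_eq_add[OF ad_J_cs[OF z(1), of a Y] ad_J_cs[OF z(1), of b u]]
        ad_J_cs[OF z(1), of c z]] by (simp add: u_def)
  also have "\<dots> \<doteq> cscale a u"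
    using u(2) zJz by (simp add: mod_eq_def)
  finally have a: "a = 0"
    using u(1) cscale_A_D mod_eq_0 mod_eq_sym by blast
  have b: "b = 0"
  proof (rule ccontr)
    assume b: "b \<noteq> 0"
    have "cscale (inverse b) (cscale b u + cscale c z) \<in> A"
      using eq a by (auto simp: u_def simp del: cscale_simps(1))
    then have *: "u \<doteq> cscale (- (c / b)) z"
      using b by (simp add: mod_eq_def divide_inverse mult.commute[of c] flip: cscale_mult)
    then have "c / b = 0"
      using ad_J_no_fixpoint[OF z(1)] by (metis u_def neg_equal_0_iff_equal)
    with * have "u \<in> A"
      by (simp add: mod_eq_0)
    with u(1) show False by contradiction
  qed
  have "c = 0"
    using eq a b z(2) cscale_A_D by auto
  with a b show ?thesis by simp
qed

lemma adapted_frame_inj: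
  assumes zY: "adapted z Y" and w: "w \<in> A" "w \<noteq> 0"
    and eq: "cscale a Y + cscale b (br (J z) Y) + cscale c z + cscale d w = 0"
  shows "a = 0 \<and> b = 0 \<and> c = 0 \<and> d = 0"
proof -
  have "cscale a Y + cscale b (br (J z) Y) + cscale c z = - cscale d w"
    using eq by (simp add: eq_neg_iff_add_eq_0)
  then have *: "a = 0" "b = 0" "c = 0"
    using adapted_independent[OF zY] w(1) A_simps(5) cscale_A by metis+
  then have "cscale d w = 0"
    using eq by simp
  then have "d = 0"
    using w(2) cscale_mult[of "inverse d" d w] by (metis cscale_simps(5,7) left_inverse)
  with * show ?thesis by simp
qed

lemma adapted_zero_iff:
  assumes "adapted z Y" "cscale b (br (J z) Y) + cscale c z \<in> A"
  shows "b = 0 \<and> c = 0"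
  using adapted_independent[OF assms(1), of 0 b c] assms(2) by simp

text \<open>Any element outside \<open>A\<close> of the last term of the lower central series that is not contained in
  \<open>A\<close> will do.\<close>
lemma central_mod_exists:
  "\<exists>z k. central_mod z \<and> z \<in> lower_central br k \<and> lower_central br (Suc k) \<subseteq> A"
proof -
  obtain K where K: "lower_central br K = {0}"
    using nilpotent by (auto simp: nilpotent_def)
  define m where "m = (LEAST m. lower_central br m \<subseteq> A)"
  have "lower_central br K \<subseteq> A"
    using K by simp
  then have m: "lower_central br m \<subseteq> A"
    unfolding m_def by (rule LeastI)
  have min: "\<not> lower_central br k \<subseteq> A" if "k < m" for k
    using not_less_Least that unfolding m_def by blast
  have "m \<noteq> 0"
    using m A_proper by auto
  then obtain k where k: "m = Suc k"
    using not0_implies_Suc by blast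
  obtain z where z: "z \<in> lower_central br k" "z \<notin> A"
    using min[of k] k by auto
  have "br z y \<in> A" for y
    using br_mem_lower_central[OF z(1), of y] m k br_antisym[of z y] by auto
  then show ?thesis
    using z m k by (auto simp: central_mod_def)
qed

text \<open>In other words, the quotient by \<open>A\<close> has a nonzero closed \<open>(1,0)\<close>-form. If the terms of index
  \<open>k\<close> of the lower central series together with their \<open>J\<close>-images and \<open>A\<close> span everything, then so do
  those of index \<open>k + 1\<close>: expanding a bracket of \<open>p + J q + a\<close> and \<open>p' + J q' + a'\<close>, the only
  term that is not obviously deeper is \<open>[J q, J q']\<close>, and integrability rewrites it. In the end
  \<open>A\<close> would be everything.\<close>
lemma derived_J_span_proper:
  "\<exists>x. x \<notin> span (lower_central br 1 \<union> J ` lower_central br 1 \<union> A)"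
proof (rule ccontr)
  assume all: "\<not> ?thesis"
  define M where "M k = span (lower_central br k \<union> J ` lower_central br k \<union> A)" for k
  have M_form: "\<exists>p\<in>lower_central br k. \<exists>q\<in>lower_central br k. \<exists>a\<in>A. x = p + J q + a"
    if "x \<in> M k" for x k
  proof -
    let ?T = "{p + J q + a | p q a. p \<in> lower_central br k \<and> q \<in> lower_central br k \<and> a \<in> A}"
    have L: "subspace (lower_central br k)"
      by (rule subspace_lower_central)
    have "subspace ?T"
      unfolding subspace_def
    proof (intro conjI ballI allI)
      show "0 \<in> ?T"
        using subspace_0[OF L] A_simps(1) by force
      fix x y assume "x \<in> ?T" "y \<in> ?T"
      then obtain p q a p' q' a' where
        "x = p + J q + a" "p \<in> lower_central br k" "q \<in> lower_central br k" "a \<in> A"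
        "y = p' + J q' + a'" "p' \<in> lower_central br k" "q' \<in> lower_central br k" "a' \<in> A"
        by blast
      then show "x + y \<in> ?T"
        using subspace_add[OF L]
        by (intro CollectI exI[of _ "p + p'"] exI[of _ "q + q'"] exI[of _ "a + a'"])
          (simp add: algebra_simps)
    next
      fix c x assume "x \<in> ?T"
      then obtain p q a where
        "x = p + J q + a" "p \<in> lower_central br k" "q \<in> lower_central br k" "a \<in> A"
        by blast
      then show "c *\<^sub>R x \<in> ?T"
        using subspace_scale[OF L]
        by (intro CollectI exI[of _ "c *\<^sub>R p"] exI[of _ "c *\<^sub>R q"] exI[of _ "c *\<^sub>R a"])
          (simp add: algebra_simps)
    qed
    moreover have "lower_central br k \<union> J ` lower_central br k \<union> A \<subseteq> ?T"
      using subspace_0[OF L] A_simps(1) by (fastforce intro: exI[of _ 0])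
    ultimately have "M k \<subseteq> ?T"
      unfolding M_def by (rule span_minimal[rotated])
    then show ?thesis
      using that by blast
  qed
  have "M (Suc k) = UNIV" for k
  proof (induction k)
    case 0
    show ?case
      using all by (auto simp: M_def)
  next
    case (Suc k)
    let ?C = "lower_central br (Suc (Suc k))"
    have sub: "?C \<subseteq> M (Suc (Suc k))" "J ` ?C \<subseteq> M (Suc (Suc k))" "A \<subseteq> M (Suc (Suc k))"
      unfolding M_def by (auto intro: span_base)
    have "br x y \<in> {v. v \<in> M (Suc (Suc k)) \<and> J v \<in> M (Suc (Suc k))}" for x y
    proof -
      obtain p q a where x: "p \<in> lower_central br (Suc k)" "q \<in> lower_central br (Suc k)" "a \<in> A"
          "x = p + J q + a"
        using M_form[of x] Suc by blast
      obtain p' q' a' where y: "p' \<in> lower_central br (Suc k)" "q' \<in> lower_central br (Suc k)"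
          "a' \<in> A" "y = p' + J q' + a'"
        using M_form[of y] Suc by blast
      define c1 where "c1 = br p y + br (J q) p' + br q q'"
      define c2 where "c2 = br (J q) q' + br q (J q')"
      define c3 where "c3 = br (J q) a' + br a y"
      have "c1 \<in> ?C" "c2 \<in> ?C" "c3 \<in> A"
        unfolding c1_def c2_def c3_def using x y br_mem_lower_central_left
            br_mem_lower_central br_A br_A_left
        by (auto intro!: subspace_add[OF subspace_lower_central] simp del: lower_central.simps)
      moreover have "br x y = c1 + J c2 + c3"
        by (simp add: x(4) y(4) c1_def c2_def c3_def br_J_J algebra_simps)
      moreover have "J (c1 + J c2 + c3) = J c1 - c2 + J c3"
        by simp
      moreover have "subspace (M (Suc (Suc k)))"
        by (simp add: M_def)
      ultimately show ?thesis
        using sub J_A[of c3] by (auto intro!: subspace_add subspace_diff)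
    qed
    moreover have "subspace {v. v \<in> M (Suc (Suc k)) \<and> J v \<in> M (Suc (Suc k))}"
      unfolding M_def by (auto simp: subspace_def intro: span_add span_scale span_zero)
    ultimately have "span {br x y | x y. y \<in> UNIV} \<subseteq> {v. v \<in> M (Suc (Suc k)) \<and> J v \<in> M (Suc (Suc k))}"
      by (intro span_minimal) blast+
    then have "lower_central br 1 \<subseteq> {v. v \<in> M (Suc (Suc k)) \<and> J v \<in> M (Suc (Suc k))}"
      by (simp only: One_nat_def lower_central.simps)
    then have "M 1 \<subseteq> M (Suc (Suc k))"
      using sub unfolding M_def by (intro span_minimal) auto
    moreover have "M 1 = UNIV"
      using all by (auto simp: M_def)
    ultimately show ?case by blast
  qed
  moreover obtain K where "lower_central br K = {0}"
    using nilpotent by (auto simp: nilpotent_def)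
  then have "lower_central br (Suc K) \<subseteq> {0}"
    using lower_central_Suc_subset[of br K] by simp
  then have "M (Suc K) \<subseteq> A"
    unfolding M_def using A_subspace by (intro span_minimal) auto
  ultimately show False
    using A_proper by auto
qed

text \<open>The four complex multiples give eight independent real directions.\<close>
lemma adapted_basis:
  assumes zY: "adapted z Y" and w: "w \<in> A" "w \<noteq> 0" and dim: "dim (UNIV :: 'a set) = 8"
  shows "\<exists>a b c d. x = cscale a Y + cscale b (br (J z) Y) + cscale c z + cscale d w"
proof -
  define u where "u = br (J z) Y"
  define F where "F v = cscale (Complex (v $ 1) (v $ 2)) Y + cscale (Complex (v $ 3) (v $ 4)) u +
    cscale (Complex (v $ 5) (v $ 6)) z + cscale (Complex (v $ 7) (v $ 8)) w" for v :: "real ^ 8"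
  have lin: "linear F"
    by (rule linearI) (simp_all add: F_def cscale_def algebra_simps)
  have "v = 0" if "F v = 0" for v
    using that adapted_frame_inj[OF zY w, of "Complex (v $ 1) (v $ 2)" "Complex (v $ 3) (v $ 4)"
        "Complex (v $ 5) (v $ 6)" "Complex (v $ 7) (v $ 8)"]
    by (simp add: F_def u_def vec_eq_iff forall_8 complex_eq_iff)
  then have "inj F"
    using lin by (simp add: linear_injective_0)
  then have "surj F"
    using surj_if_inj_dim_8[OF lin _ dim] by blast
  then obtain v where "x = F v"
    by (metis surjD)
  then show ?thesis
    unfolding F_def u_def by blast
qed

lemma A_eq_line:
  assumes "w \<in> A" "w \<noteq> 0" "dim (UNIV :: 'a set) = 8" "x \<in> A"
  shows "\<exists>d. x = cscale d w"
proof -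
  obtain z Y where zY: "adapted z Y"
    using central_mod_exists adapted_exists by blast
  obtain a b c d where x: "x = cscale a Y + cscale b (br (J z) Y) + cscale c z + cscale d w"
    using adapted_basis[OF zY assms(1,2,3)] by blast
  have "cscale a Y + cscale b (br (J z) Y) + cscale c z = x - cscale d w"
    using x by simp
  then have "a = 0 \<and> b = 0 \<and> c = 0"
    using adapted_independent[OF zY] assms(1,4) A_simps(3) cscale_A by metis
  then show ?thesis
    using x by auto
qed

end

text \<open>In dimension eight centrality of \<open>A\<close> is automatic as soon as \<open>A\<close> contains a nonzero element
  \<open>w\<close> for which \<open>w\<close> and \<open>J w\<close> are central, by \<open>A_eq_line\<close>.\<close>
locale central_saturated_ideal = saturated_ideal +
  assumes dim_8: "dim (UNIV :: 'a set) = 8"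
    and A_central: "x \<in> A \<Longrightarrow> br x y = 0"
    and A_nonzero: "A \<noteq> {0}"
begin

lemma A_central_right: "x \<in> A \<Longrightarrow> br y x = 0"
  using A_central br_antisym[of x y] by simp

lemma exists_coords:
  assumes "adapted z Y"
  shows "\<exists>a b c. \<exists>d\<in>A. x = cscale a Y + cscale b (br (J z) Y) + cscale c z + d"
proof -
  obtain w where "w \<in> A" "w \<noteq> 0"
    using A_nonzero A_simps(1) by blast
  then show ?thesis
    using adapted_basis[OF assms _ _ dim_8, of w x] cscale_A by blast
qed

text \<open>The complex hyperplane on which the coordinate of \<open>Y\<close> vanishes.\<close>
definition hyperplane :: "'a \<Rightarrow> 'a \<Rightarrow> 'a set" where
  "hyperplane z Y = {cscale b (br (J z) Y) + cscale c z + d | b c d. d \<in> A}"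

text \<open>A bracket outside the hyperplane would, together with \<open>u\<close> and \<open>z\<close>, generate everything over
  the complex numbers, against \<open>derived_J_span_proper\<close>.\<close>
lemma bracket_in_hyperplane:
  assumes zY: "adapted z Y" and z: "z \<in> lower_central br 1"
  shows "br x y \<in> hyperplane z Y"
proof -
  define u where "u = br (J z) Y"
  define M where "M = span (lower_central br 1 \<union> J ` lower_central br 1 \<union> A)"
  have J_M: "J v \<in> M" if "v \<in> M" for v
  proof -
    have "J ` (lower_central br 1 \<union> J ` lower_central br 1 \<union> A) \<subseteq> M"
      using J_A by (auto simp: M_def intro!: span_neg intro: span_base)
    then show ?thesis
      using that linear_span_image[OF linear_J] span_minimal[OF _ subspace_span]
      unfolding M_def by (metis (no_types, lifting) imageI subsetD)
  qed
  then have cs_M: "cscale c v \<in> M" if "v \<in> M" for c v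
    using that unfolding cscale_def M_def by (auto intro: span_add span_scale)
  have br_M: "br v w \<in> M" for v w
    unfolding M_def by (auto intro: span_base)
  have A_M: "A \<subseteq> M"
    unfolding M_def by (auto intro: span_base)
  have "z \<in> M" "u \<in> M"
    using z br_M unfolding u_def M_def by (auto intro: span_base)
  obtain a b c d where xy: "br x y = cscale a Y + cscale b u + cscale c z + d" "d \<in> A"
    using exists_coords[OF zY] u_def by metis
  have "a = 0"
  proof (rule ccontr)
    assume a: "a \<noteq> 0"
    have "cscale a Y = br x y - cscale b u - cscale c z - d"
      using xy(1) by simp
    also have "\<dots> \<in> M"
      using br_M cs_M \<open>z \<in> M\<close> \<open>u \<in> M\<close> xy(2) A_M unfolding M_def
      by (intro span_diff) auto
    finally have "cscale (inverse a) (cscale a Y) \<in> M"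
      by (rule cs_M)
    then have "Y \<in> M"
      using a by (simp flip: cscale_mult)
    have "v \<in> M" for v
    proof -
      obtain a' b' c' d' where v: "v = cscale a' Y + cscale b' u + cscale c' z + d'" "d' \<in> A"
        using exists_coords[OF zY] u_def by metis
      then show ?thesis
        using cs_M \<open>z \<in> M\<close> \<open>u \<in> M\<close> \<open>Y \<in> M\<close> A_M unfolding M_def
        by (auto intro!: span_add)
    qed
    then show False
      using derived_J_span_proper M_def by blast
  qed
  then show ?thesis
    using xy by (auto simp: hyperplane_def u_def)
qed

text \<open>If the last term of the lower central series outside \<open>A\<close> were the derived algebra, then the
  brackets \<open>u = [J z, Y]\<close> and \<open>[J z, J Y]\<close>, the latter congruent to \<open>J u\<close>, would both be central
  modulo \<open>A\<close>; but \<open>u \<notin> A\<close>.\<close>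
lemma adapted_exists_deep:
  "\<exists>z Y. adapted z Y \<and> z \<in> lower_central br 2"
proof -
  obtain z k where z: "central_mod z" "z \<in> lower_central br k" "lower_central br (Suc k) \<subseteq> A"
    using central_mod_exists by blast
  obtain Y where Y: "adapted z Y"
    using adapted_exists[OF z(1)] by blast
  define u where "u = br (J z) Y"
  have "k \<noteq> 0"
  proof
    assume "k = 0"
    then have "br x y \<in> A" for x y
      using z(3) br_mem_lower_central[of y br 0 x] by auto
    then show False
      using A_saturated A_proper by blast
  qed
  moreover have "k \<noteq> 1"
  proof
    assume k: "k = 1"
    have u: "br u y \<in> A" for y
      using z(3) br_mem_lower_central[of Y br 0 "J z"] br_mem_lower_central_left[of u 1 y]
      unfolding k u_def by auto
    have "br (br (J z) (J Y)) y \<in> A" for y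
      using z(3) br_mem_lower_central[of "J Y" br 0 "J z"]
        br_mem_lower_central_left[of "br (J z) (J Y)" 1 y]
      unfolding k by auto
    moreover have "br (J u) y = br (br (J z) (J Y)) y" for y
      using ad_J_commutes[OF z(1), of Y] A_central[of "br (J z) (J Y) - J u" y]
      by (simp add: mod_eq_def u_def)
    ultimately have "u \<in> A"
      using A_saturated u by metis
    then show False
      using Y by (simp add: adapted_def u_def)
  qed
  ultimately have "2 \<le> k" by simp
  then show ?thesis
    using z(2) Y lower_central_mono[of 2 k br] by blast
qed

end

section \<open>The structure equations\<close>

context central_saturated_ideal
begin

lemma mod_eq_br_eq: "x \<doteq> y \<Longrightarrow> br v x = br v y" and mod_eq_br_left_eq: "x \<doteq> y \<Longrightarrow> br x v = br y v"
  using A_central_right[of "x - y" v] A_central[of "x - y" v] by (simp_all add: mod_eq_def)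

lemma subspace_hyperplane: "subspace (hyperplane z Y)"
  unfolding subspace_def hyperplane_def
proof (intro conjI ballI allI)
  let ?u = "br (J z) Y"
  show "0 \<in> {cscale b ?u + cscale c z + d |b c d. d \<in> A}"
    by (intro CollectI exI[of _ 0]) simp
  fix x y assume "x \<in> {cscale b ?u + cscale c z + d |b c d. d \<in> A}" "y \<in> {cscale b ?u + cscale c z
      + d |b c d. d \<in> A}"
  then obtain b c d b' c' d' where "x = cscale b ?u + cscale c z + d" "d \<in> A" "y = cscale b' ?u
      + cscale c' z + d'" "d' \<in> A"
    by blast
  then show "x + y \<in> {cscale b ?u + cscale c z + d |b c d. d \<in> A}"
    by (intro CollectI exI[of _ "b + b'"] exI[of _ "c + c'"] exI[of _ "d + d'"])
      (simp add: cscale_add algebra_simps)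
next
  let ?u = "br (J z) Y"
  fix r x assume "x \<in> {cscale b ?u + cscale c z + d |b c d. d \<in> A}"
  then obtain b c d where "x = cscale b ?u + cscale c z + d" "d \<in> A"
    by blast
  then show "r *\<^sub>R x \<in> {cscale b ?u + cscale c z + d |b c d. d \<in> A}"
    by (intro CollectI exI[of _ "of_real r * b"] exI[of _ "of_real r * c"] exI[of _ "r *\<^sub>R d"])
      (simp add: cscale_mult algebra_simps)
qed

text \<open>The brackets modulo \<open>A\<close>, apart from \<open>[Y, J Y]\<close>.\<close>
definition reduced_frame :: "'a \<Rightarrow> 'a \<Rightarrow> real \<Rightarrow> bool" where
  "reduced_frame z Y \<gamma> \<longleftrightarrow> adapted z Y \<and> \<gamma> \<noteq> 0 \<and>
     (let u = br (J z) Y in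
       br Y u \<doteq> \<gamma> *\<^sub>R z \<and> br Y (J u) \<in> A \<and> br (J Y) u \<in> A \<and> br (J Y) (J u) \<doteq> \<gamma> *\<^sub>R z \<and>
       br u (J u) \<in> A)"

lemma adapted_brackets:
  assumes zY: "adapted z Y"
  defines "u \<equiv> br (J z) Y"
  shows "br z y \<in> A" "br y z \<in> A" "br (J z) u \<in> A" "br (J z) (J u) \<in> A" "br u (J z) \<in> A"
    "br (J u) (J z) \<in> A" "br (J z) (J Y) \<doteq> J u" "u \<notin> A" "z \<notin> A"
proof -
  have z: "central_mod z"
    using zY by (simp add: adapted_def)
  show 1: "br z y \<in> A" "z \<notin> A" for y
    using z by (simp_all add: central_mod_def)
  show "br y z \<in> A"
    using A_simps(5)[OF 1(1)] br_antisym[of y z] by simp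
  show 3: "br (J z) u \<in> A" "u \<notin> A"
    using zY by (simp_all add: adapted_def u_def)
  show 4: "br (J z) (J u) \<in> A"
    using ad_J_commutes[OF z, of u] mod_eq_mem J_A 3(1) by blast
  show "br u (J z) \<in> A" "br (J u) (J z) \<in> A"
    using A_simps(5)[OF 3(1)] A_simps(5)[OF 4] br_antisym[of u "J z"] br_antisym[of "J u" "J z"]
    by simp_all
  show "br (J z) (J Y) \<doteq> J u"
    using ad_J_commutes[OF z, of Y] by (simp add: u_def)
qed

text \<open>The hyperplane \<open>K\<close> spanned by \<open>u, z, A\<close> contains all brackets, and \<open>ad (J z)\<close> maps it into
  \<open>A\<close>; applied to \<open>[Y, J Y]\<close> and \<open>[Y, J u]\<close>, this gives \<open>[J Y, u] \<doteq> [Y, J u]\<close> and \<open>[u, J u] \<in> A\<close>.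
  So \<open>K\<close> is abelian modulo \<open>A\<close>, and the action of \<open>Y, J Y\<close> on it is determined by
  \<open>p = [Y, u] \<doteq> p\<^sub>2 u + p\<^sub>3 z\<close> and \<open>q = [Y, J u] \<doteq> q\<^sub>2 u + q\<^sub>3 z\<close>. Three applications of nilpotency
  finish the proof: \<open>[\<gg>, K] \<noteq> K\<close> modulo \<open>A\<close> shows that no bracket with \<open>K\<close> has a component along
  \<open>J z\<close>, which makes \<open>p\<^sub>3\<close> real and \<open>q\<^sub>3\<close> zero; modulo the ideal spanned by \<open>A\<close> and \<open>z\<close>, the plane
  of \<open>u, J u\<close> must not reproduce itself, which makes \<open>q\<^sub>2\<close> zero; and likewise for the vector
  \<open>p\<^sub>2 u\<close>. Finally \<open>p\<^sub>3 \<noteq> 0\<close> because \<open>z\<close> is a combination of double brackets.\<close>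
lemma reduced_frame_exists:
  "\<exists>z Y \<gamma>. reduced_frame z Y \<gamma> \<and> br Y (J Y) \<in> hyperplane z Y"
proof -
  obtain z Y where zY: "adapted z Y" and z2: "z \<in> lower_central br 2"
    using adapted_exists_deep by blast
  then have z1: "z \<in> lower_central br 1"
    using lower_central_mono[of 1 2 br] by auto
  define u where "u = br (J z) Y"
  note basic = adapted_brackets[OF zY, folded u_def]
  note bracket_hyp = bracket_in_hyperplane[OF zY z1]
  define p where "p = br Y u"
  define q where "q = br Y (J u)"
  define q' where "q' = br (J Y) u"
  define p' where "p' = br (J Y) (J u)"
  have p': "p' = p + J q + J q'"
    by (simp add: p'_def p_def q_def q'_def br_J_J algebra_simps)
  have ad_hyp: "br (J z) x \<in> A" if x: "x \<in> hyperplane z Y" for x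
  proof -
    obtain b c d where "x = cscale b u + cscale c z + d" "d \<in> A"
      using x by (auto simp: hyperplane_def u_def)
    then show ?thesis
      using basic by (simp add: cscale_def A_central_right)
  qed
  have qq': "q - q' \<in> A"
  proof -
    have "br (J z) (br Y (J Y)) = br u (J Y) + br Y (br (J z) (J Y))"
      using leibniz[of "J z" Y "J Y"] by (simp add: u_def)
    also have "br Y (br (J z) (J Y)) = q"
      using mod_eq_br_eq[OF basic(7)] by (simp add: q_def)
    finally show ?thesis
      using ad_hyp[OF bracket_hyp, of Y "J Y"] br_antisym[of u "J Y"] by (simp add: q'_def)
  qed
  have uJu: "br u (J u) \<in> A"
  proof -
    have "br (J z) (br Y (J u)) = br u (J u) + br Y (br (J z) (J u))"
      using leibniz[of "J z" Y "J u"] by (simp add: u_def)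
    then show ?thesis
      using ad_hyp[OF bracket_hyp, of Y "J u"] A_central_right[OF basic(4)] by simp
  qed
  then have Juu: "br (J u) u \<in> A"
    using A_simps(5) br_antisym[of "J u" u] by fastforce
  have Jq: "J q = (1/2) *\<^sub>R (p' - p + J (q - q'))"
    by (simp add: p' scaleR_2 flip: scaleR_left_distrib)
  \<comment> \<open>\<open>R\<close> contains \<open>[\<gg>, K]\<close>, and \<open>R_W\<close> below says that modulo \<open>A\<close> it contains nothing else.\<close>
  define R where "R = span ({u, J u, p, q, J q} \<union> A)"
  have subR: "subspace R"
    by (simp add: R_def)
  note R_closed = subspace_add[OF subR] subspace_diff[OF subR] subspace_scale[OF subR]
      subspace_0[OF subR]
  have A_R: "x \<in> R" if "x \<in> A" for x
    using that unfolding R_def by (intro span_base) blast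
  have gen_R: "u \<in> R" "J u \<in> R" "p \<in> R" "q \<in> R" "J q \<in> R"
    unfolding R_def by (auto intro: span_base)
  have "q' \<in> R"
    using R_closed(2)[OF gen_R(4) A_R[OF qq']] by simp
  have "p' = p + J q + J q - J (q - q')"
    by (simp add: p')
  then have "p' \<in> R"
    using R_closed gen_R A_R[OF J_A[OF qq']] by metis
  have br_R: "br x v \<in> R" if v: "v \<in> hyperplane z Y" for x v
  proof -
    obtain a b c d where x: "x = cscale a Y + cscale b u + cscale c z + d" "d \<in> A"
      using exists_coords[OF zY] u_def by metis
    obtain b' c' d' where v: "v = cscale b' u + cscale c' z + d'" "d' \<in> A"
      using v by (auto simp: hyperplane_def u_def)
    have "br x u = Re a *\<^sub>R p + Im a *\<^sub>R q' + (Im b *\<^sub>R br (J u) u + Re c *\<^sub>R br z u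
        + Im c *\<^sub>R br (J z) u)"
      using x by (simp add: cscale_def p_def q'_def A_central)
    also have "\<dots> \<in> R"
      using basic Juu by (intro R_closed A_R A_simps gen_R \<open>q' \<in> R\<close>)
    finally have 1: "br x u \<in> R" .
    have "br x (J u) = Re a *\<^sub>R q + Im a *\<^sub>R p' + (Re b *\<^sub>R br u (J u) + Re c *\<^sub>R br z (J u)
        + Im c *\<^sub>R br (J z) (J u))"
      using x by (simp add: cscale_def q_def p'_def A_central)
    also have "\<dots> \<in> R"
      using basic uJu by (intro R_closed A_R A_simps gen_R \<open>p' \<in> R\<close>)
    finally have 2: "br x (J u) \<in> R" .
    have "br (J z) x = Re a *\<^sub>R u + Im a *\<^sub>R J u + (Im a *\<^sub>R (br (J z) (J Y) - J u) +
        Re b *\<^sub>R br (J z) u + Im b *\<^sub>R br (J z) (J u) + Re c *\<^sub>R br (J z) z)"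
      using x by (simp add: cscale_def u_def A_central_right algebra_simps)
    also have "\<dots> \<in> R"
      using basic by (intro R_closed(1,3) A_R gen_R) (simp add: mod_eq_def)
    finally have 3: "br x (J z) \<in> R"
      using br_antisym[of x "J z"] R_closed(3)[of "br (J z) x" "-1"] by simp
    have "br x v = Re b' *\<^sub>R br x u + Im b' *\<^sub>R br x (J u) + Re c' *\<^sub>R br x z + Im c' *\<^sub>R br x (J z)"
      using v by (simp add: cscale_def A_central_right)
    also have "\<dots> \<in> R"
      by (intro R_closed(1,3) 1 2 3 A_R[OF basic(2)])
    finally show ?thesis .
  qed
  have z_R: "z \<in> R"
  proof -
    have "span {br x y | x y. y \<in> UNIV} \<subseteq> hyperplane z Y"
      using bracket_hyp by (intro span_minimal subspace_hyperplane) blast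
    then have "lower_central br 1 \<subseteq> hyperplane z Y"
      by (simp only: One_nat_def lower_central.simps)
    then have "span {br x y | x y. y \<in> lower_central br 1} \<subseteq> R"
      using br_R by (intro span_minimal subR) blast
    moreover have "lower_central br 2 = span {br x y | x y. y \<in> lower_central br 1}"
      by (simp only: numeral_2_eq_2 One_nat_def lower_central.simps(2)[of br "Suc 0"])
    ultimately show ?thesis
      using z2 by blast
  qed
  define W where "W V I = span ({br x v |x v. v \<in> V} \<union> I)" for V I
  have W_closed: "x \<in> W V I \<Longrightarrow> y \<in> W V I \<Longrightarrow> x + y \<in> W V I"
    "x \<in> W V I \<Longrightarrow> y \<in> W V I \<Longrightarrow> x - y \<in> W V I" "x \<in> W V I \<Longrightarrow> r *\<^sub>R x \<in> W V I"
    "v \<in> V \<Longrightarrow> br x v \<in> W V I" "x \<in> I \<Longrightarrow> x \<in> W V I" for x y r v V I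
    unfolding W_def by (auto intro: span_add span_diff span_scale span_base)
  have in_hyperplane: "u \<in> hyperplane z Y" "J u \<in> hyperplane z Y" "J z \<in> hyperplane z Y"
    unfolding hyperplane_def u_def[symmetric]
    by (intro CollectI exI[of _ 1] exI[of _ 0], simp) (intro CollectI exI[of _ \<i>] exI[of _ 0], simp,
      intro CollectI exI[of _ 0] exI[of _ \<i>], simp)
  have R_W: "R \<subseteq> W (hyperplane z Y) A"
    unfolding R_def
  proof (rule span_minimal)
    show "subspace (W (hyperplane z Y) A)"
      by (simp add: W_def)
    have "u = - br Y (J z)"
      using br_antisym[of Y "J z"] by (simp add: u_def)
    then have "u \<in> W (hyperplane z Y) A"
      using W_closed(3)[OF W_closed(4)[OF in_hyperplane(3), of Y], where r = "-1"] by simp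
    moreover have "J u \<in> W (hyperplane z Y) A"
    proof -
      have D0: "br (J z) (J Y) - J u \<in> A"
        using basic(7) by (simp add: mod_eq_def)
      have "J u = (- 1) *\<^sub>R br (J Y) (J z) - (br (J z) (J Y) - J u)"
        using br_antisym[of "J Y" "J z"] by simp
      also have "\<dots> \<in> W (hyperplane z Y) A"
        by (rule W_closed(2)[OF W_closed(3)[OF W_closed(4)[OF in_hyperplane(3)]] W_closed(5)[OF D0]])
      finally show ?thesis .
    qed
    moreover have pW: "p \<in> W (hyperplane z Y) A" "q \<in> W (hyperplane z Y) A" "p' \<in> W (hyperplane z Y) A"
      unfolding p_def q_def p'_def using in_hyperplane by (auto intro: W_closed)
    moreover have "J q \<in> W (hyperplane z Y) A"
      unfolding Jq by (rule W_closed(3)[OF W_closed(1)[OF W_closed(2)[OF pW(3,1)]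
          W_closed(5)[OF J_A[OF qq']]]])
    ultimately show "{u, J u, p, q, J q} \<union> A \<subseteq> W (hyperplane z Y) A"
      using W_closed(5) by auto
  qed
  have Im_0: "Im c = 0" if x: "cscale b u + cscale c z + d \<in> R" and d: "d \<in> A" for b c d
  proof (rule ccontr)
    assume c: "Im c \<noteq> 0"
    have cs_u: "cscale b u \<in> R" for b
      unfolding cscale_def by (rule R_closed(1)[OF R_closed(3)[OF gen_R(1)] R_closed(3)[OF gen_R(2)]])
    have "Im c *\<^sub>R J z = cscale b u + cscale c z + d - cscale b u - Re c *\<^sub>R z - d"
      by (simp add: cscale_def)
    also have "\<dots> \<in> R"
      by (rule R_closed(2)[OF R_closed(2)[OF R_closed(2)[OF x cs_u] R_closed(3)[OF z_R]] A_R[OF d]])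
    finally have "J z \<in> R"
      using R_closed(3)[of "Im c *\<^sub>R J z" "inverse (Im c)"] c by simp
    then have "cscale c z \<in> R" for c
      unfolding cscale_def using R_closed(1)[OF R_closed(3)[OF z_R] R_closed(3)] by blast
    then have "cscale b u + cscale c z + d \<in> R" if "d \<in> A" for b c d
      using R_closed(1)[OF R_closed(1)[OF cs_u] A_R[OF that]] by blast
    then have "hyperplane z Y \<subseteq> R"
      unfolding hyperplane_def u_def[symmetric] by blast
    then have "hyperplane z Y \<subseteq> A"
      using nilpotent_absorb[OF nilpotent A_subspace br_A,
          of "hyperplane z Y"] R_W unfolding W_def by blast
    then show False
      using in_hyperplane(1) basic(8) by blast
  qed
  obtain p2 p3 pa where p: "p = cscale p2 u + cscale p3 z + pa" "pa \<in> A"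
    using bracket_hyp[of Y u] by (auto simp: hyperplane_def u_def p_def)
  obtain q2 q3 qa where q: "q = cscale q2 u + cscale q3 z + qa" "qa \<in> A"
    using bracket_hyp[of Y "J u"] by (auto simp: hyperplane_def u_def q_def)
  have "Im p3 = 0" "Im q3 = 0"
    using Im_0 p q gen_R by metis+
  have Jq': "J q = cscale (\<i> * q2) u + cscale (\<i> * q3) z + J qa"
    using q by (simp add: cscale_mult)
  then have "Im (\<i> * q3) = 0"
    using Im_0 gen_R(5) J_A[OF q(2)] by metis
  with \<open>Im q3 = 0\<close> have "q3 = 0"
    by (simp add: complex_eq_iff)
  with q Jq' have q_u: "q = cscale q2 u + qa" "J q = J (cscale q2 u) + J qa"
    by (simp_all add: cscale_mult)
  define \<gamma> where "\<gamma> = Re p3"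
  have p3: "p3 = of_real \<gamma>"
    using \<open>Im p3 = 0\<close> by (simp add: \<gamma>_def complex_eq_iff)
  have "\<gamma> \<noteq> 0"
  proof
    assume "\<gamma> = 0"
    let ?U = "{cscale b u + d |b d. d \<in> A}"
    have "subspace ?U"
      unfolding subspace_def
    proof (intro conjI ballI allI)
      show "0 \<in> ?U"
        by (intro CollectI exI[of _ 0]) simp
      fix x y assume "x \<in> ?U" "y \<in> ?U"
      then obtain b d b' d' where "x = cscale b u + d" "d \<in> A" "y = cscale b' u + d'" "d' \<in> A"
        by blast
      then show "x + y \<in> ?U"
        by (intro CollectI exI[of _ "b + b'"] exI[of _ "d + d'"]) (simp add: cscale_add algebra_simps)
    next
      fix r x assume "x \<in> ?U"
      then obtain b d where "x = cscale b u + d" "d \<in> A"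
        by blast
      then show "r *\<^sub>R x \<in> ?U"
        by (intro CollectI exI[of _ "of_real r * b"] exI[of _ "r *\<^sub>R d"])
          (simp add: cscale_mult algebra_simps)
    qed
    moreover have "{u, J u, p, q, J q} \<union> A \<subseteq> ?U"
    proof -
      have U: "cscale b u + d \<in> ?U" if "d \<in> A" for b d
        using that by blast
      have "J q = cscale (\<i> * q2) u + J qa"
        by (simp add: q_u(2) cscale_mult)
      then show ?thesis
        using U[of 0 1] U[of 0 \<i>] U[OF p(2), of p2] U[OF q(2), of q2] U[OF J_A[OF q(2)],
            of "\<i> * q2"] U[of _ 0]
        by (auto simp: q_u(1) p p3 \<open>\<gamma> = 0\<close> cscale_mult)
    qed
    ultimately have "R \<subseteq> ?U"
      unfolding R_def by (rule span_minimal[rotated])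
    then obtain b d where "z = cscale b u + d" "d \<in> A"
      using z_R by blast
    then have "cscale (- b) u + cscale 1 z \<in> A"
      by simp
    then show False
      using adapted_zero_iff[OF zY, of "- b" 1] by (simp add: u_def)
  qed
  \<comment> \<open>As \<open>z\<close> is central modulo \<open>A\<close>, this is an ideal.\<close>
  define I1 where "I1 = {r *\<^sub>R z + d |r d. d \<in> A}"
  have I1: "r *\<^sub>R z + d \<in> I1" if "d \<in> A" for r d
    using that by (auto simp: I1_def)
  have sub_I1: "subspace I1"
    unfolding subspace_def
  proof (intro conjI ballI allI)
    show "0 \<in> I1"
      using I1[of 0 0] by simp
    fix x y assume "x \<in> I1" "y \<in> I1"
    then obtain b d b' d' where "x = b *\<^sub>R z + d" "d \<in> A" "y = b' *\<^sub>R z + d'" "d' \<in> A"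
      unfolding I1_def by blast
    then show "x + y \<in> I1"
      using I1[of "d + d'" "b + b'"] by (simp add: algebra_simps)
  next
    fix r x assume "x \<in> I1"
    then obtain b d where "x = b *\<^sub>R z + d" "d \<in> A"
      unfolding I1_def by blast
    then show "r *\<^sub>R x \<in> I1"
      using I1[of "r *\<^sub>R d" "r * b"] by (simp add: algebra_simps)
  qed
  have br_I1: "br x y \<in> I1" if "y \<in> I1" for x y
  proof -
    obtain r d where "y = r *\<^sub>R z + d" "d \<in> A"
      using \<open>y \<in> I1\<close> unfolding I1_def by blast
    then show ?thesis
      using I1[of "r *\<^sub>R br x z" 0] basic(2)[of x] by (simp add: A_central_right)
  qed
  have no_I1: "b = 0" if "cscale b u \<in> I1" for b
  proof -
    obtain r d where "cscale b u = r *\<^sub>R z + d" "d \<in> A"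
      using \<open>cscale b u \<in> I1\<close> unfolding I1_def by blast
    then have "cscale b u + cscale (of_real (- r)) z \<in> A"
      by (simp del: of_real_minus)
    then show ?thesis
      using adapted_zero_iff[OF zY] u_def by metis
  qed
  \<comment> \<open>Otherwise \<open>q\<close> and \<open>J q\<close>, which are brackets up to \<open>A\<close>, span the same plane as \<open>u\<close> and \<open>J u\<close>.\<close>
  have "q2 = 0"
  proof (rule ccontr)
    assume q2: "q2 \<noteq> 0"
    let ?W = "W {u, J u} I1"
    let ?v = "cscale q2 u"
    have A_W: "x \<in> ?W" if "x \<in> A" for x
      using I1[OF that, of 0] by (auto intro: W_closed)
    have "?v = br Y (J u) - qa"
      using q_u(1) by (simp add: q_def)
    then have v: "?v \<in> ?W"
      using A_W[OF q(2)] by (auto intro: W_closed)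
    have pW: "p \<in> ?W" "p' \<in> ?W"
      unfolding p_def p'_def by (auto intro: W_closed)
    have "J q \<in> ?W"
      unfolding Jq by (rule W_closed(3)[OF W_closed(1)[OF W_closed(2)[OF pW(2,1)] A_W[OF J_A[OF qq']]]])
    then have "J ?v \<in> ?W"
      using q_u(2) W_closed(2)[OF _ A_W[OF J_A[OF q(2)]]] by fastforce
    then have "cscale c ?v \<in> ?W" for c
      unfolding cscale_def[of c ?v] using W_closed(1)[OF W_closed(3)[OF v] W_closed(3)] by blast
    then have "cscale (c / q2 * q2) u \<in> ?W" for c
      by (simp only: cscale_mult)
    then have all: "cscale c u \<in> ?W" for c
      using q2 by simp
    have "{u, J u} \<subseteq> I1"
    proof (rule nilpotent_absorb[OF nilpotent sub_I1 br_I1])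
      show "v \<in> span ({br x v' |x v'. v' \<in> {u, J u}} \<union> I1)" if "v \<in> {u, J u}" for v
        using that all[of 1] all[of \<i>] by (auto simp: W_def)
    qed
    then show False
      using no_I1[of 1] by simp
  qed
  then have "q = qa" "q \<in> A"
    using q_u(1) q(2) by simp_all
  then have "q' \<in> A"
    using A_simps(3)[OF _ qq'] by fastforce
  \<comment> \<open>Modulo \<open>I1\<close> the vector \<open>v = p\<^sub>2 u\<close> satisfies \<open>[Y, v] = Re p\<^sub>2 v\<close> and \<open>[J Y, v] = Im p\<^sub>2 v\<close>.\<close>
  have "p2 = 0"
  proof (rule ccontr)
    assume p2: "p2 \<noteq> 0"
    let ?v = "cscale p2 u"
    let ?W = "W {?v} I1"
    have A_W: "x \<in> ?W" if "x \<in> A" for x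
      using I1[OF that, of 0] by (auto intro: W_closed)
    have "z \<in> I1"
      using I1[of 0 1] by simp
    then have z_W: "z \<in> ?W"
      by (rule W_closed)
    have "br Y ?v = Re p2 *\<^sub>R p + Im p2 *\<^sub>R q"
      by (simp add: cscale_def p_def q_def)
    then have "Re p2 *\<^sub>R ?v = br Y ?v - (Re p2 * \<gamma>) *\<^sub>R z - (Re p2 *\<^sub>R pa + Im p2 *\<^sub>R q)"
      using p(1) p3 by (simp add: algebra_simps)
    also have "\<dots> \<in> ?W"
      by (rule W_closed(2)[OF W_closed(2)[OF W_closed(4) W_closed(3)[OF z_W]] A_W])
        (use p(2) \<open>q \<in> A\<close> in simp_all)
    finally have 1: "Re p2 *\<^sub>R ?v \<in> ?W" .
    have "br (J Y) ?v = Re p2 *\<^sub>R q' + Im p2 *\<^sub>R p'"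
      by (simp add: cscale_def p'_def q'_def)
    then have "Im p2 *\<^sub>R ?v = br (J Y) ?v - (Im p2 * \<gamma>) *\<^sub>R z - (Im p2 *\<^sub>R (pa + J q + J q')
        + Re p2 *\<^sub>R q')"
      using p(1) p3 p' by (simp add: algebra_simps)
    also have "\<dots> \<in> ?W"
      by (rule W_closed(2)[OF W_closed(2)[OF W_closed(4) W_closed(3)[OF z_W]] A_W])
        (use p(2) \<open>q \<in> A\<close> \<open>q' \<in> A\<close> J_A in simp_all)
    finally have 2: "Im p2 *\<^sub>R ?v \<in> ?W" .
    have "?v \<in> ?W"
    proof (cases "Re p2 = 0")
      case True
      then have "Im p2 \<noteq> 0"
        using p2 by (simp add: complex_eq_iff)
      then show ?thesis
        using W_closed(3)[OF 2, of "inverse (Im p2)"] by simp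
    next
      case False
      then show ?thesis
        using W_closed(3)[OF 1, of "inverse (Re p2)"] by simp
    qed
    then have "{?v} \<subseteq> I1"
      using nilpotent_absorb[OF nilpotent sub_I1 br_I1, of "{?v}"] by (auto simp: W_def)
    then show False
      using no_I1 p2 by simp
  qed
  then have "p \<doteq> \<gamma> *\<^sub>R z"
    using p p3 by (simp add: mod_eq_def)
  moreover have "p' \<doteq> \<gamma> *\<^sub>R z"
    using p p3 \<open>p2 = 0\<close> J_A[OF \<open>q \<in> A\<close>] J_A[OF \<open>q' \<in> A\<close>] by (simp add: mod_eq_def p' add.assoc)
  ultimately have "reduced_frame z Y \<gamma>"
    unfolding reduced_frame_def Let_def u_def[symmetric]
    using zY \<open>\<gamma> \<noteq> 0\<close> \<open>q \<in> A\<close> \<open>q' \<in> A\<close> uJu by (simp add: p_def q_def q'_def p'_def)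
  then show ?thesis
    using bracket_hyp by blast
qed

lemma reduced_frameD:
  assumes "reduced_frame z Y \<gamma>"
  defines "u \<equiv> br (J z) Y"
  shows "adapted z Y" "\<gamma> \<noteq> 0" "br Y u \<doteq> \<gamma> *\<^sub>R z" "br Y (J u) \<in> A" "br (J Y) u \<in> A"
    "br (J Y) (J u) \<doteq> \<gamma> *\<^sub>R z" "br u (J u) \<in> A"
  using assms by (simp_all add: reduced_frame_def Let_def)

text \<open>Adding \<open>z\<close>, \<open>J z\<close> and \<open>J u\<close> to \<open>Y\<close> changes \<open>[Y, J Y]\<close> by \<open>- u\<close>, \<open>J u\<close> and \<open>- 2 \<gamma> z\<close>, while the
  other brackets do not change modulo \<open>A\<close>. This removes all components except the one along
  \<open>J z\<close>.\<close>
lemma reduced_frame_shift: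
  assumes rf: "reduced_frame z Y \<gamma>" and L: "br Y (J Y) \<in> hyperplane z Y"
  shows "\<exists>Y' \<epsilon>. reduced_frame z Y' \<gamma> \<and> br Y' (J Y') \<doteq> \<epsilon> *\<^sub>R J z"
proof -
  define u where "u = br (J z) Y"
  note rfD = reduced_frameD[OF rf, folded u_def]
  note basic = adapted_brackets[OF rfD(1), folded u_def]
  obtain b c d where YJY: "br Y (J Y) = cscale b u + cscale c z + d" "d \<in> A"
    using L by (auto simp: hyperplane_def u_def)
  define \<kappa> where "\<kappa> = Re c / (2 * \<gamma>)"
  define k where "k = Re b *\<^sub>R z + (- Im b) *\<^sub>R J z + \<kappa> *\<^sub>R J u"
  define u' where "u' = br (J z) (Y + k)"
  have u': "u' = u + (Re b *\<^sub>R br (J z) z + \<kappa> *\<^sub>R br (J z) (J u))"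
    by (simp add: u'_def u_def k_def)
  then have uu: "u' \<doteq> u"
    using basic by (simp add: mod_eq_def)
  have Juu: "br (J u) u \<in> A"
    using rfD(7) A_simps(5) br_antisym[of "J u" u] by simp
  have JY: "J (Y + k) = J Y + (Re b *\<^sub>R J z + Im b *\<^sub>R z - \<kappa> *\<^sub>R u)"
    by (simp add: k_def)
  have "br (Y + k) u' \<doteq> \<gamma> *\<^sub>R z"
  proof -
    have "br (Y + k) u' = br (Y + k) u"
      by (rule mod_eq_br_eq[OF uu])
    also have "\<dots> - \<gamma> *\<^sub>R z = (br Y u - \<gamma> *\<^sub>R z) + Re b *\<^sub>R br z u + (- Im b) *\<^sub>R br (J z) u
        + \<kappa> *\<^sub>R br (J u) u"
      by (simp add: k_def)
    also have "\<dots> \<in> A"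
      using basic Juu rfD(3) by (simp add: mod_eq_def)
    finally show ?thesis
      by (simp add: mod_eq_def)
  qed
  moreover have "br (Y + k) (J u') \<in> A"
  proof -
    have "br (Y + k) (J u') = br (Y + k) (J u)"
      by (rule mod_eq_br_eq[OF mod_eq_J[OF uu]])
    also have "\<dots> = br Y (J u) + Re b *\<^sub>R br z (J u) + (- Im b) *\<^sub>R br (J z) (J u)"
      by (simp add: k_def)
    also have "\<dots> \<in> A"
      using basic rfD(4) by simp
    finally show ?thesis .
  qed
  moreover have "br (J (Y + k)) u' \<in> A"
  proof -
    have "br (J (Y + k)) u' = br (J (Y + k)) u"
      by (rule mod_eq_br_eq[OF uu])
    also have "\<dots> = br (J Y) u + Re b *\<^sub>R br (J z) u + Im b *\<^sub>R br z u"
      unfolding JY by simp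
    also have "\<dots> \<in> A"
      using basic rfD(5) by simp
    finally show ?thesis .
  qed
  moreover have "br (J (Y + k)) (J u') \<doteq> \<gamma> *\<^sub>R z"
  proof -
    have "br (J (Y + k)) (J u') = br (J (Y + k)) (J u)"
      by (rule mod_eq_br_eq[OF mod_eq_J[OF uu]])
    also have "\<dots> - \<gamma> *\<^sub>R z = (br (J Y) (J u) - \<gamma> *\<^sub>R z) + Re b *\<^sub>R br (J z) (J u) + Im b *\<^sub>R br z (J u)
        - \<kappa> *\<^sub>R br u (J u)"
      unfolding JY by simp
    also have "\<dots> \<in> A"
      using basic rfD(6,7) by (simp add: mod_eq_def)
    finally show ?thesis
      by (simp add: mod_eq_def)
  qed
  moreover have "br u' (J u') \<in> A"
    using rfD(7) mod_eq_br_eq[OF mod_eq_J[OF uu]] mod_eq_br_left_eq[OF uu] by simp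
  moreover have "adapted z (Y + k)"
    using rfD(1) basic(3,8) mod_eq_mem[OF uu] mod_eq_br_eq[OF uu, of "J z"]
    by (simp add: adapted_def u'_def[symmetric] del: br_simps)
  ultimately have "reduced_frame z (Y + k) \<gamma>"
    using rfD(2) by (simp add: reduced_frame_def Let_def u'_def[symmetric] del: br_simps J_simps)
  moreover have "br (Y + k) (J (Y + k)) \<doteq> Im c *\<^sub>R J z"
  proof -
    have c: "Re c *\<^sub>R z = \<kappa> *\<^sub>R \<gamma> *\<^sub>R z + \<kappa> *\<^sub>R \<gamma> *\<^sub>R z"
      using rfD(2) by (simp add: \<kappa>_def flip: scaleR_left_distrib)
    have anti: "br Y (J z) = - u" "br (J u) (J Y) = - br (J Y) (J u)"
      using br_antisym[of Y "J z"] br_antisym[of "J u" "J Y"] by (simp_all add: u_def)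
    have "br (Y + k) (J (Y + k)) - Im c *\<^sub>R J z =
        d + Im b *\<^sub>R br Y z - \<kappa> *\<^sub>R (br Y u - \<gamma> *\<^sub>R z)
        + Re b *\<^sub>R (br z (J Y) + Re b *\<^sub>R br z (J z) - \<kappa> *\<^sub>R br z u)
        - Im b *\<^sub>R ((br (J z) (J Y) - J u) + Im b *\<^sub>R br (J z) z - \<kappa> *\<^sub>R br (J z) u)
        - \<kappa> *\<^sub>R (br (J Y) (J u) - \<gamma> *\<^sub>R z)
        + \<kappa> *\<^sub>R (Re b *\<^sub>R br (J u) (J z) + Im b *\<^sub>R br (J u) z - \<kappa> *\<^sub>R br (J u) u)"
      unfolding JY k_def by (simp add: YJY(1) anti cscale_def[of b] cscale_def[of c] c algebra_simps)
    also have "\<dots> \<in> A"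
      using basic Juu rfD(3,6) YJY(2) by (simp add: mod_eq_def)
    finally show ?thesis
      by (simp add: mod_eq_def)
  qed
  ultimately show ?thesis by blast
qed

text \<open>Scaling \<open>z\<close> scales \<open>u\<close> as well and thus preserves \<open>\<gamma>\<close>; it turns \<open>\<epsilon>\<close> into \<open>1\<close> unless it is zero.\<close>
lemma reduced_frame_scale:
  assumes rf: "reduced_frame z Y \<gamma>" and r: "r \<noteq> 0"
  shows "reduced_frame (r *\<^sub>R z) Y \<gamma>"
proof -
  note rfD = reduced_frameD[OF rf]
  have mem: "r *\<^sub>R x \<in> A \<longleftrightarrow> x \<in> A" for x
    using A_simps(4)[of x r] A_simps(4)[of "r *\<^sub>R x" "inverse r"] r by auto
  have eq: "r *\<^sub>R x \<doteq> \<gamma> *\<^sub>R r *\<^sub>R y \<longleftrightarrow> x \<doteq> \<gamma> *\<^sub>R y" for x y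
    using mem[of "x - \<gamma> *\<^sub>R y"] by (simp add: mod_eq_def algebra_simps)
  show ?thesis
    using rf r mem eq by (simp add: reduced_frame_def Let_def adapted_def central_mod_def)
qed

lemma reduced_frame_cong:
  assumes rf: "reduced_frame z Y \<gamma>" and z: "z' \<doteq> z"
  shows "reduced_frame z' Y \<gamma>" "br (J z') Y = br (J z) Y"
proof -
  show u: "br (J z') Y = br (J z) Y"
    by (rule mod_eq_br_left_eq[OF mod_eq_J[OF z]])
  have "x \<doteq> \<gamma> *\<^sub>R z' \<longleftrightarrow> x \<doteq> \<gamma> *\<^sub>R z" for x
    using mod_eq_scale[OF z, of \<gamma>] mod_eq_trans mod_eq_sym by blast
  then show "reduced_frame z' Y \<gamma>"
    using rf mod_eq_mem[OF z] mod_eq_br_left_eq[OF z] mod_eq_br_left_eq[OF mod_eq_J[OF z]]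
    by (simp add: reduced_frame_def Let_def adapted_def central_mod_def u)
qed

text \<open>Since \<open>A\<close> is central, replacing \<open>z\<close> by the congruent element \<open>[Y, u] / \<gamma>\<close> does not change
  \<open>u\<close>, so that one of the congruences becomes an equation.\<close>
lemma normalised_frame_exists:
  "\<exists>z Y \<gamma> \<epsilon>. reduced_frame z Y \<gamma> \<and> br Y (br (J z) Y) = \<gamma> *\<^sub>R z \<and>
     (\<epsilon> = 0 \<or> \<epsilon> = 1) \<and> br Y (J Y) \<doteq> \<epsilon> *\<^sub>R J z"
proof -
  obtain z Y \<gamma> where rf: "reduced_frame z Y \<gamma>" and "br Y (J Y) \<in> hyperplane z Y"
    using reduced_frame_exists by blast
  then obtain Y' \<epsilon> where rf': "reduced_frame z Y' \<gamma>" and \<epsilon>: "br Y' (J Y') \<doteq> \<epsilon> *\<^sub>R J z"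
    using reduced_frame_shift by blast
  obtain z1 \<epsilon>' where z1: "reduced_frame z1 Y' \<gamma>" "br Y' (J Y') \<doteq> \<epsilon>' *\<^sub>R J z1" "\<epsilon>' = 0 \<or> \<epsilon>' = 1"
  proof (cases "\<epsilon> = 0")
    case True
    then show ?thesis
      using that[OF rf', of 0] \<epsilon> by simp
  next
    case False
    then show ?thesis
      using that[OF reduced_frame_scale[OF rf' False], of 1] \<epsilon> by simp
  qed
  note rfD = reduced_frameD[OF z1(1)]
  define z2 where "z2 = inverse \<gamma> *\<^sub>R br Y' (br (J z1) Y')"
  have z2: "z2 \<doteq> z1"
    using mod_eq_scale[OF rfD(3), of "inverse \<gamma>"] rfD(2) by (simp add: z2_def)
  have "br Y' (br (J z2) Y') = \<gamma> *\<^sub>R z2"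
    using reduced_frame_cong(2)[OF z1(1) z2] rfD(2) by (simp add: z2_def)
  moreover have "br Y' (J Y') \<doteq> \<epsilon>' *\<^sub>R J z2"
    using mod_eq_trans[OF z1(2) mod_eq_scale[OF mod_eq_J[OF mod_eq_sym[OF z2]]]] .
  ultimately show ?thesis
    using reduced_frame_cong(1)[OF z1(1) z2] z1(3) by blast
qed

text \<open>The brackets themselves, in terms of \<open>a\<close>, \<open>e\<close> and \<open>[Y, J Y]\<close>. Each follows from the previous
  ones by one Jacobi identity or one instance of integrability, as brackets with elements of \<open>A\<close>
  vanish.\<close>
lemma bracket_table:
  assumes rf: "reduced_frame z Y \<gamma>" and Yu: "br Y (br (J z) Y) = \<gamma> *\<^sub>R z"
    and \<epsilon>: "br Y (J Y) \<doteq> \<epsilon> *\<^sub>R J z"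
  defines "u \<equiv> br (J z) Y"
  defines "a \<equiv> br Y (J u)" and "e \<equiv> br u (J z)"
  shows "br (J Y) u = a" "br (J z) z = 0" "\<gamma> *\<^sub>R br z (J Y) = - \<epsilon> *\<^sub>R e" "br u (J u) = 0"
    "br z (J u) = 0" "br z u = 0" "br (J u) (J z) = J e" "\<gamma> *\<^sub>R br z Y = \<epsilon> *\<^sub>R J e"
    "br (J z) (J Y) = J u" "br (J Y) (J u) = \<gamma> *\<^sub>R z + 2 *\<^sub>R J a"
proof -
  note rfD = reduced_frameD[OF rf, folded u_def]
  note basic = adapted_brackets[OF rfD(1), folded u_def]
  have Tu: "br (J z) Y = u" and Yu: "br Y u = \<gamma> *\<^sub>R z"
    using Yu by (simp_all add: u_def)
  have YJY: "br x (br Y (J Y)) = \<epsilon> *\<^sub>R br x (J z)" for x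
    using mod_eq_br_eq[OF \<epsilon>] by simp
  have c0: "x \<in> A \<Longrightarrow> br x y = 0" "x \<in> A \<Longrightarrow> br y x = 0" for x y
    using A_central A_central_right by blast+
  show Ju: "br (J Y) u = a"
    using leibniz[of "J z" Y "J Y"] YJY[of "J z"] mod_eq_br_eq[OF basic(7), of Y] br_antisym[of "J Y" u]
    by (simp add: Tu a_def neg_eq_iff_add_eq_0)
  show Tz: "br (J z) z = 0"
    using leibniz[of "J z" Y u] c0(2)[OF basic(3)] rfD(2) by (simp add: Tu Yu)
  have "br u Y = - \<gamma> *\<^sub>R z"
    using br_antisym[of u Y] Yu by simp
  moreover have "br u (J Y) \<in> A"
    using rfD(5) br_antisym[of u "J Y"] by simp
  ultimately show zJY: "\<gamma> *\<^sub>R br z (J Y) = - \<epsilon> *\<^sub>R e"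
    using leibniz[of u Y "J Y"] YJY[of u] c0(2) by (simp add: e_def)
  show uJu: "br u (J u) = 0"
    using leibniz[of "J z" Y "J u"] c0(2)[OF rfD(4)] c0(2)[OF basic(4)] by (simp add: Tu)
  show zJu: "br z (J u) = 0"
    using leibniz[of Y u "J u"] uJu c0(2)[OF rfD(4)] rfD(2) by (simp add: Yu)
  show zu: "br z u = 0"
    using leibniz[of "J Y" u "J u"] uJu c0(1)[OF rfD(5)] mod_eq_br_eq[OF rfD(6), of u] rfD(2)
      br_antisym[of z u] by simp
  show JuT: "br (J u) (J z) = J e"
    using br_J_J[of u z] zu zJu br_antisym[of u z] br_antisym[of "J u" z] by (simp add: e_def)
  have "br (J u) (J Y) \<doteq> - \<gamma> *\<^sub>R z"
    using mod_eq_scale[OF rfD(6), of "-1"] br_antisym[of "J u" "J Y"] by simp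
  moreover have "br (J u) Y \<in> A"
    using rfD(4) br_antisym[of "J u" Y] by simp
  ultimately show zY: "\<gamma> *\<^sub>R br z Y = \<epsilon> *\<^sub>R J e"
    using leibniz[of "J u" Y "J Y"] YJY[of "J u"] c0(1) mod_eq_br_eq[of _ _ Y] JuT br_antisym[of Y z]
    by simp
  have "\<gamma> *\<^sub>R br z Y + J (\<gamma> *\<^sub>R br z (J Y)) = 0"
    by (simp add: zY zJY del: J_simps(2)) simp
  then have "\<gamma> *\<^sub>R (br z Y + J (br z (J Y))) = 0"
    by (simp add: scaleR_right_distrib)
  then have "br z Y + J (br z (J Y)) = 0"
    using rfD(2) by simp
  then show "br (J z) (J Y) = J u"
    using br_J_J[of z Y] by (simp add: Tu algebra_simps)
  show "br (J Y) (J u) = \<gamma> *\<^sub>R z + 2 *\<^sub>R J a"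
    using br_J_J[of Y u] Ju by (simp add: Yu a_def scaleR_2)
qed

end

section \<open>Classification\<close>

context central_saturated_ideal
begin

lemma model_isomorphic:
  assumes rf: "reduced_frame z Y \<gamma>" and Yu: "br Y (br (J z) Y) = \<gamma> *\<^sub>R z"
    and \<epsilon>: "br Y (J Y) = \<epsilon> *\<^sub>R J z + cscale \<beta> w"
    and a: "br Y (J (br (J z) Y)) = cscale \<alpha> w"
    and e: "br (br (J z) Y) (J z) = s *\<^sub>R w"
    and w: "w \<in> A" "w \<noteq> 0"
  shows "lie_isomorphic (model \<epsilon> s (Re \<alpha>) (Im \<alpha>) (Re \<beta>) (Im \<beta>)) br"
proof -
  define u where "u = br (J z) Y"
  have "br Y (J Y) \<doteq> \<epsilon> *\<^sub>R J z"
    using \<epsilon> w(1) by (simp add: mod_eq_def)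
  note table = bracket_table[OF rf Yu this, folded u_def, unfolded a[folded u_def] e[folded u_def]]
  note rfD = reduced_frameD[OF rf]
  have \<gamma>: "\<gamma> \<noteq> 0"
    by (rule rfD(2))
  define S where "S = \<gamma> *\<^sub>R z"
  define T where "T = J z"
  note central = A_central[OF w(1)] A_central_right[OF w(1)] A_central[OF J_A[OF w(1)]]
    A_central_right[OF J_A[OF w(1)]]
  have Tu: "br T Y = u"
    by (simp add: T_def u_def)
  have tab: "br Y (J Y) = \<epsilon> *\<^sub>R T + Re \<beta> *\<^sub>R w + Im \<beta> *\<^sub>R J w"
    "br T Y = u" "br T (J Y) = J u" "br Y u = S" "br Y (J u) = Re \<alpha> *\<^sub>R w + Im \<alpha> *\<^sub>R J w"
    "br (J Y) u = Re \<alpha> *\<^sub>R w + Im \<alpha> *\<^sub>R J w"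
    "br (J Y) (J u) = S + (2 * Re \<alpha>) *\<^sub>R J w - (2 * Im \<alpha>) *\<^sub>R w"
    "br u (J u) = 0" "br u T = s *\<^sub>R w" "br (J u) T = s *\<^sub>R J w"
    "br S Y = (\<epsilon> * s) *\<^sub>R J w" "br S (J Y) = - (\<epsilon> * s) *\<^sub>R w"
    "br S u = 0" "br S (J u) = 0" "br S T = 0"
    using table Yu[folded u_def] \<epsilon> a[folded u_def] e[folded u_def] Tu br_antisym[of S T]
    by (simp_all add: T_def[symmetric] S_def cscale_def br_antisym[of z T]
      scaleR_right_diff_distrib scaleR_right_distrib)
  note tab = tab tab[THEN arg_cong[where f = uminus], folded br_antisym]
  define F where "F v = v $ 1 *\<^sub>R Y + v $ 2 *\<^sub>R J Y + v $ 3 *\<^sub>R u + v $ 4 *\<^sub>R J u +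
    v $ 5 *\<^sub>R S + v $ 6 *\<^sub>R T + v $ 7 *\<^sub>R w + v $ 8 *\<^sub>R J w" for v :: "real ^ 8"
  have lin: "linear F"
    by (rule linearI) (simp_all add: F_def algebra_simps)
  have "v = 0" if "F v = 0" for v
  proof -
    have "cscale (Complex (v $ 1) (v $ 2)) Y + cscale (Complex (v $ 3) (v $ 4)) (br (J z) Y) +
      cscale (Complex (\<gamma> * v $ 5) (v $ 6)) z + cscale (Complex (v $ 7) (v $ 8)) w = F v"
      by (simp add: F_def cscale_def S_def T_def u_def mult.commute)
    then show ?thesis
      using adapted_frame_inj[OF rfD(1) w, of "Complex (v $ 1) (v $ 2)" "Complex (v $ 3) (v $ 4)"
          "Complex (\<gamma> * v $ 5) (v $ 6)" "Complex (v $ 7) (v $ 8)"] \<open>F v = 0\<close> \<gamma>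
      by (simp add: vec_eq_iff forall_8 complex_eq_iff)
  qed
  then have inj: "inj F"
    using lin by (simp add: linear_injective_0)
  then have "bij F"
    using surj_if_inj_dim_8[OF lin _ dim_8] by (simp add: bij_def)
  moreover have "F (model \<epsilon> s (Re \<alpha>) (Im \<alpha>) (Re \<beta>) (Im \<beta>) x y) = br (F x) (F y)" for x y
    unfolding F_def model_def
    by (simp add: coord_simps tab central algebra_simps)
  ultimately show ?thesis
    using lin unfolding lie_isomorphic_def by blast
qed

text \<open>The generator \<open>w\<close> of \<open>A\<close> is the first nonzero one among \<open>e\<close>, \<open>a\<close> and \<open>b\<close>; the remaining
  parameters are then coefficients with respect to \<open>w\<close>.\<close>
lemma isomorphic_wnn_algebra: "\<exists>f\<in>wnn_algebras. lie_isomorphic br f"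
proof -
  obtain z Y \<gamma> \<epsilon> where rf: "reduced_frame z Y \<gamma>" and Yu: "br Y (br (J z) Y) = \<gamma> *\<^sub>R z"
    and \<epsilon>: "\<epsilon> = 0 \<or> \<epsilon> = 1" and YJY: "br Y (J Y) \<doteq> \<epsilon> *\<^sub>R J z"
    using normalised_frame_exists by blast
  define u where "u = br (J z) Y"
  define a where "a = br Y (J u)"
  define b where "b = br Y (J Y) - \<epsilon> *\<^sub>R J z"
  define e where "e = br u (J z)"
  have mem: "a \<in> A" "b \<in> A" "e \<in> A"
    using reduced_frameD[OF rf] adapted_brackets[of z Y] YJY
    by (simp_all add: a_def b_def e_def u_def mod_eq_def)
  have b: "br Y (J Y) = \<epsilon> *\<^sub>R J z + b"
    by (simp add: b_def)
  have line: "\<exists>c. x = cscale c w" if "w \<in> A" "w \<noteq> 0" "x \<in> A" for x w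
    using A_eq_line dim_8 that by blast
  have model: "\<exists>f\<in>wnn_algebras. lie_isomorphic br f"
    if "lie_isomorphic (model d s a1 a2 b1 b2) br" "lie_isomorphic f (model d s a1 a2 b1 b2)"
      "f \<in> wnn_algebras" for f d s a1 a2 b1 b2
    using lie_isomorphic_sym[OF lie_isomorphic_trans[OF that(2,1)]] that(3) by blast
  have m: "lie_isomorphic (model \<epsilon> s (Re \<alpha>) (Im \<alpha>) (Re \<beta>) (Im \<beta>)) br"
    if "w \<in> A" "w \<noteq> 0" "a = cscale \<alpha> w" "b = cscale \<beta> w" "e = s *\<^sub>R w" for s \<alpha> \<beta> w
    using model_isomorphic[OF rf Yu, of \<epsilon> \<beta> w \<alpha> s] b that by (simp add: a_def e_def u_def)
  have wnn: "f1 \<in> wnn_algebras" "f2 \<in> wnn_algebras" "f3 \<in> wnn_algebras" "f4 0 \<in> wnn_algebras"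
    "f4 1 \<in> wnn_algebras" "f5 0 \<in> wnn_algebras" "f5 1 \<in> wnn_algebras" "f6 \<in> wnn_algebras"
    "f7 \<in> wnn_algebras" "f8 \<in> wnn_algebras"
    by (simp_all add: wnn_algebras_def)
  consider (e) "e \<noteq> 0" | (a) "e = 0" "a \<noteq> 0" | (b) "e = 0" "a = 0" "b \<noteq> 0" | (0) "e = 0" "a = 0" "b = 0"
    by blast
  then show ?thesis
  proof cases
    case e
    obtain \<alpha> \<beta> where ab: "a = cscale \<alpha> e" "b = cscale \<beta> e"
      using line[OF mem(3) e] mem by metis
    have M: "lie_isomorphic (model \<epsilon> 1 (Re \<alpha>) (Im \<alpha>) (Re \<beta>) (Im \<beta>)) br"
      using m[OF mem(3) e ab, of 1] by simp
    show ?thesis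
      using \<epsilon>
    proof
      assume \<epsilon>: "\<epsilon> = 0"
      consider "\<alpha> \<noteq> 0" | "\<alpha> = 0" "\<beta> \<noteq> 0" | "\<alpha> = 0" "\<beta> = 0"
        by blast
      then show ?thesis
      proof cases
        case 1
        then show ?thesis
          using model[OF _ model_f7] M wnn \<epsilon> by (simp add: complex_eq_iff)
      next
        case 2
        then show ?thesis
          using model[OF _ model_f5_1] M wnn \<epsilon> by (simp add: complex_eq_iff)
      next
        case 3
        then show ?thesis
          using model[OF _ model_f5_0] M wnn \<epsilon> by simp
      qed
    next
      assume \<epsilon>: "\<epsilon> = 1"
      show ?thesis
      proof (cases "\<alpha> = 0")
        case True
        then show ?thesis
          using model[OF _ model_f6] M wnn \<epsilon> by simp
      next
        case False
        then show ?thesis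
          using model[OF _ model_f8] M wnn \<epsilon> by (simp add: complex_eq_iff)
      qed
    qed
  next
    case a
    then obtain \<beta> where "b = cscale \<beta> a"
      using line[OF mem(1)] mem by metis
    then have M: "lie_isomorphic (model \<epsilon> 0 1 0 (Re \<beta>) (Im \<beta>)) br"
      using m[OF mem(1) a(2), of 1 \<beta> 0] a by simp
    show ?thesis
      using \<epsilon>
    proof
      assume "\<epsilon> = 0"
      then show ?thesis
        using model[OF _ model_f4_0] M wnn by simp
    next
      assume "\<epsilon> = 1"
      then show ?thesis
        using model[OF _ model_f4_1] M wnn by simp
    qed
  next
    case b
    then have M: "lie_isomorphic (model \<epsilon> 0 0 0 1 0) br"
      using m[OF mem(2) b(3), of 0 1 0] by simp
    show ?thesis
      using \<epsilon>
    proof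
      assume "\<epsilon> = 0"
      then show ?thesis
        using model[OF _ model_f3] M wnn by simp
    next
      assume "\<epsilon> = 1"
      then show ?thesis
        using model[OF _ model_f2] M wnn by simp
    qed
  next
    case 0
    obtain w where w: "w \<in> A" "w \<noteq> 0"
      using A_nonzero A_simps(1) by blast
    then have M: "lie_isomorphic (model \<epsilon> 0 0 0 0 0) br"
      using m[OF w, of 0 0 0] 0 by simp
    show ?thesis
      using \<epsilon>
    proof
      assume "\<epsilon> = 0"
      then show ?thesis
        using model[OF _ model_f1] M wnn by simp
    next
      assume "\<epsilon> = 1"
      then show ?thesis
        using model[OF _ model_f2] M wnn by simp
    qed
  qed
qed

end

text \<open>The terms of the ascending series form an increasing chain of \<open>J\<close>-invariant ideals.\<close>
lemma asc_series_ideal: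
  assumes "lie_algebra br" "linear J" "\<And>x. J (J x) = - x"
  shows "subspace (asc_series br J k) \<and> (\<forall>x\<in>asc_series br J k. J x \<in> asc_series br J k) \<and>
    (\<forall>x\<in>asc_series br J k. \<forall>y. br y x \<in> asc_series br J k) \<and>
    asc_series br J k \<subseteq> asc_series br J (Suc k)"
proof -
  interpret lie_algebra br by fact
  note [simp] = linear_add[OF assms(2)] linear_scale[OF assms(2)] linear_0[OF assms(2)]
    linear_neg[OF assms(2)] assms(3)
  show ?thesis
  proof (induction k)
    case 0
    then show ?case by (simp add: subspace_0)
  next
    case (Suc k)
    then have sub: "subspace (asc_series br J k)"
      and mono: "x \<in> asc_series br J k \<Longrightarrow> x \<in> asc_series br J (Suc k)" for x
      by auto
    have S: "subspace (asc_series br J (Suc k))"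
      using sub by (auto simp: subspace_def)
    moreover have "\<forall>x\<in>asc_series br J (Suc k). J x \<in> asc_series br J (Suc k)"
      using subspace_neg[OF sub] by simp
    moreover have "\<forall>x\<in>asc_series br J (Suc k). \<forall>y. br y x \<in> asc_series br J (Suc k)"
      using mono subspace_neg[OF S] br_antisym
      by (metis (mono_tags, lifting) asc_series.simps(2) mem_Collect_eq)
    moreover have "asc_series br J (Suc k) \<subseteq> asc_series br J (Suc (Suc k))"
    proof
      fix x assume "x \<in> asc_series br J (Suc k)"
      then have "\<forall>y. br x y \<in> asc_series br J k" "\<forall>y. br (J x) y \<in> asc_series br J k"
        by simp_all
      then have "\<forall>y. br x y \<in> asc_series br J (Suc k)" "\<forall>y. br (J x) y \<in> asc_series br J (Suc k)"
        using mono by blast+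
      then show "x \<in> asc_series br J (Suc (Suc k))"
        unfolding asc_series.simps(2)[of br J "Suc k"] by blast
    qed
    ultimately show ?case by blast
  qed
qed

lemma wnn_imp_isomorphic:
  fixes br :: "'a::real_vector \<Rightarrow> 'a \<Rightarrow> 'a"
  assumes br: "lie_algebra br" and dim: "dim (UNIV :: 'a set) = 8" and nil: "nilpotent br"
    and J: "complex_structure br J" and wnn: "weakly_non_nilpotent br J"
  shows "\<exists>f\<in>wnn_algebras. lie_isomorphic br f"
proof -
  obtain t where t: "t > 0" "\<And>l. l \<ge> 1 \<Longrightarrow> asc_series br J t = asc_series br J (t + l)"
      "asc_series br J t \<noteq> UNIV" and a1: "asc_series br J 1 \<noteq> {0}"
    using wnn by (auto simp: weakly_non_nilpotent_def)
  define A where "A = asc_series br J t"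
  have lin: "linear J" "\<And>x. J (J x) = - x"
    using J by (auto simp: complex_structure_def)
  note asc = asc_series_ideal[OF br lin]
  have Suc: "asc_series br J (Suc t) = A"
    using t(2)[of 1] by (simp add: A_def)
  interpret saturated_ideal br J A
  proof (unfold_locales)
    show "nilpotent br" "complex_structure br J"
      by fact+
    show "subspace A"
      unfolding A_def using asc by blast
    show "J x \<in> A" if "x \<in> A" for x
      using asc[of t] that by (simp add: A_def)
    show "br x y \<in> A" if "y \<in> A" for x y
      using asc[of t] that by (simp add: A_def)
    show "x \<in> A" if "\<And>y. br x y \<in> A" "\<And>y. br (J x) y \<in> A" for x
    proof -
      have "x \<in> asc_series br J (Suc t)"
        using that by (simp add: A_def)
      then show ?thesis
        by (simp only: Suc)
    qed
    show "A \<noteq> UNIV"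
      using t(3) by (simp add: A_def)
  qed (use br in \<open>auto simp: lie_algebra_def\<close>)
  have "0 \<in> asc_series br J 1"
    using asc subspace_0 by blast
  then obtain w where w: "w \<in> asc_series br J 1" "w \<noteq> 0"
    using a1 by blast
  have "asc_series br J 1 \<subseteq> A"
    unfolding A_def using lift_Suc_mono_le[of "asc_series br J" 1 t] asc t(1) by simp
  with w have wA: "w \<in> A"
    by blast
  have "br w y = 0" "br (J w) y = 0" for y
    using w(1) by simp_all
  then have "br (cscale d w) y = 0" for d y
    by (simp add: cscale_def)
  then have "br x y = 0" if "x \<in> A" for x y
    using A_eq_line[OF wA w(2) dim that] by auto
  then interpret central_saturated_ideal br J A
    by unfold_locales (use dim wA w(2) in auto)
  show ?thesis
    by (rule isomorphic_wnn_algebra)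
qed

theorem theorem4p1:
  fixes br :: "'a::real_vector \<Rightarrow> 'a \<Rightarrow> 'a"
  assumes "lie_algebra br" and "dim (UNIV :: 'a set) = 8" and "nilpotent br"
  shows "((\<exists>J. complex_structure br J \<and> weakly_non_nilpotent br J) \<longleftrightarrow>
            (\<exists>f\<in>wnn_algebras. lie_isomorphic br f)) \<and>
         (\<forall>f\<in>wnn_algebras. \<forall>f'\<in>wnn_algebras.
            lie_isomorphic br f \<longrightarrow> lie_isomorphic br f' \<longrightarrow> f = f')"
proof (intro conjI iffI ballI impI)
  assume "\<exists>J. complex_structure br J \<and> weakly_non_nilpotent br J"
  then show "\<exists>f\<in>wnn_algebras. lie_isomorphic br f"
    using wnn_imp_isomorphic[OF assms] by blast
next
  assume "\<exists>f\<in>wnn_algebras. lie_isomorphic br f"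
  then show "\<exists>J. complex_structure br J \<and> weakly_non_nilpotent br J"
    using isomorphic_imp_wnn by blast
next
  fix f f' assume "f \<in> wnn_algebras" "f' \<in> wnn_algebras" "lie_isomorphic br f" "lie_isomorphic br f'"
  then show "f = f'"
    using wnn_algebras_distinguished bracket_invariants_cong by metis
qed

end
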